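(* Let $C\subseteq\mathbb{F}_q^n$ be a constant weight linear code of dimension $k\geqslant1$ whose non-zero codewords all have weight $d$, and let $\mathbb{K}$ be any field. Then the minimal $\mathbb{N}$-graded free resolution of the Stanley-Reisner ring $R(C)$ of its associated matroid has the form \[ 0\leftarrow R(C)\leftarrow S\leftarrow P_1\leftarrow\cdots\leftarrow P_k\leftarrow 0, \qquad P_i=S(-d_i)^{{k\brack i}_q q^{\frac{i(i-1)}{2}}}\ (1\leqslant i\leqslant k), \] where $d_i=d\,\dfrac{q^i-1}{q^{i-1}(q-1)}$ for $1\leqslant i\leqslant k$.
   Context: A constant weight code is a linear code all of whose non-zero codewords have the same number of non-zero coordinates. Let $H_C$ be an $(n-k)\times n$ parity check matrix of $C$ ($c\in C$ iff $cH_C^t=0$); the associated matroid $\Delta$ on $\{1,\dots,n\}$ has as independent sets the index sets of linearly independent columns of $H_C$, and is regarded as a simplicial complex. With $S=\mathbb{K}[x_1,\dots,x_n]$ (standard $\mathbb{N}$-grading), the Stanley-Reisner ideal is $I_\Delta=\langle\prod_{e\in\sigma}x_e:\sigma\notin\Delta\rangle$ and $R(C)=S/I_\Delta$. $S(-j)$ denotes the free module of rank one generated in degree $j$. ${k\brack i}_q=\frac{f(k,q)}{f(i,q)f(k-i,q)}$ with $f(m,q)=\prod_{j=1}^m(q^j-1)$ is the Gaussian binomial coefficient. *)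

theory Defs
  imports "HOL-Analysis.Analysis" "HOL-Library.Poly_Mapping"
begin

text \<open>Coordinates of codewords are indexed by a finite type 'n, so n = CARD('n).
  Codewords live in 'a^'n, 'a a finite field with q = CARD('a) elements.\<close>

definition hweight :: "'a::zero ^ 'n::finite \<Rightarrow> nat" where
  "hweight c = card {i. c $ i \<noteq> 0}"

definition is_parity_check :: "('a::field ^ 'n::finite) set \<Rightarrow> nat \<Rightarrow> (nat \<Rightarrow> 'a ^ 'n) \<Rightarrow> bool" where
  "is_parity_check C m H \<longleftrightarrow>
     (\<forall>c. c \<in> C \<longleftrightarrow> (\<forall>j<m. (\<Sum>i\<in>UNIV. c $ i * H j $ i) = 0))"

definition cols_indep :: "nat \<Rightarrow> (nat \<Rightarrow> 'a::field ^ 'n::finite) \<Rightarrow> 'n set \<Rightarrow> bool" where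
  "cols_indep m H \<sigma> \<longleftrightarrow>
     (\<forall>a :: 'n \<Rightarrow> 'a. (\<forall>j<m. (\<Sum>i\<in>\<sigma>. a i * H j $ i) = 0) \<longrightarrow> (\<forall>i\<in>\<sigma>. a i = 0))"

definition matroid_complex :: "nat \<Rightarrow> (nat \<Rightarrow> 'a::field ^ 'n::finite) \<Rightarrow> 'n set set" where
  "matroid_complex m H = {\<sigma>. cols_indep m H \<sigma>}"

text \<open>Polynomial ring S = K[x_i : i in 'n], monomials are exponent vectors (finitely supported).\<close>
type_synonym ('n, 'k) mpoly = "('n \<Rightarrow>\<^sub>0 nat) \<Rightarrow>\<^sub>0 'k"

definition sqfree_monomial :: "'n set \<Rightarrow> ('n, 'k::comm_ring_1) mpoly" where
  "sqfree_monomial \<sigma> = Poly_Mapping.single (\<Sum>i\<in>\<sigma>. Poly_Mapping.single i 1) 1"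

text \<open>Stanley-Reisner ideal: the ideal generated by the monomials of non-faces
  (there are finitely many, 'n being finite).\<close>
definition SR_ideal :: "'n::finite set set \<Rightarrow> ('n, 'k::comm_ring_1) mpoly set" where
  "SR_ideal \<Delta> = {p. \<exists>f. p = (\<Sum>\<sigma>\<in>{\<sigma>. \<sigma> \<notin> \<Delta>}. f \<sigma> * sqfree_monomial \<sigma>)}"

definition total_deg :: "('n \<Rightarrow>\<^sub>0 nat) \<Rightarrow> nat" where
  "total_deg m = sum (Poly_Mapping.lookup m) (Poly_Mapping.keys m)"

text \<open>p is homogeneous of (integer) degree e (p = 0 is homogeneous of any degree).\<close>
definition homogeneous_of :: "int \<Rightarrow> ('n, 'k::zero) mpoly \<Rightarrow> bool" where
  "homogeneous_of e p \<longleftrightarrow> (\<forall>m\<in>Poly_Mapping.keys p. int (total_deg m) = e)"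

text \<open>A chain of graded free S-modules and degree-preserving maps.
  P_i = (+)_{l < r i} S(- dg i l); phi i : P_i \<rightarrow> P_(i-1) is the matrix
  phi i j l (row j < r (i-1), column l < r i).  Elements of P_i are
  vectors v :: nat \<Rightarrow> S with support in {..< r i}.\<close>
definition fvecs :: "nat \<Rightarrow> (nat \<Rightarrow> 'a::zero) set" where
  "fvecs r = {v. \<forall>l\<ge>r. v l = 0}"

definition mat_apply :: "nat \<Rightarrow> nat \<Rightarrow> (nat \<Rightarrow> nat \<Rightarrow> 'a::comm_ring_1) \<Rightarrow> (nat \<Rightarrow> 'a) \<Rightarrow> (nat \<Rightarrow> 'a)" where
  "mat_apply nr nc M v = (\<lambda>j. if j < nr then (\<Sum>l<nc. M j l * v l) else 0)"

definition graded_free_resolution ::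
  "('n::finite, 'k::field) mpoly set \<Rightarrow> (nat \<Rightarrow> nat) \<Rightarrow> (nat \<Rightarrow> nat \<Rightarrow> int)
     \<Rightarrow> (nat \<Rightarrow> nat \<Rightarrow> nat \<Rightarrow> ('n, 'k) mpoly) \<Rightarrow> bool" where
  "graded_free_resolution I r dg phi \<longleftrightarrow>
     \<comment> \<open>P_0 = S, generated in degree 0\<close>
     r 0 = 1 \<and> dg 0 0 = 0 \<and>
     \<comment> \<open>all maps are graded of degree 0\<close>
     (\<forall>i\<ge>1. \<forall>j<r (i-1). \<forall>l<r i. homogeneous_of (dg i l - dg (i-1) j) (phi i j l)) \<and>
     \<comment> \<open>augmentation: coker(phi 1) = S / I, i.e. image of phi 1 is I\<close>
     (\<lambda>v. mat_apply (r 0) (r 1) (phi 1) v 0) ` fvecs (r 1) = I \<and>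
     \<comment> \<open>exactness at every P_i, i \<ge> 1\<close>
     (\<forall>i\<ge>1. {v \<in> fvecs (r i). mat_apply (r (i-1)) (r i) (phi i) v = (\<lambda>_. 0)}
               = mat_apply (r i) (r (i+1)) (phi (i+1)) ` fvecs (r (i+1)))"

text \<open>Minimality: all matrix entries lie in the homogeneous maximal ideal
  (no non-zero constant term).\<close>
definition minimal_graded_free_resolution ::
  "('n::finite, 'k::field) mpoly set \<Rightarrow> (nat \<Rightarrow> nat) \<Rightarrow> (nat \<Rightarrow> nat \<Rightarrow> int)
     \<Rightarrow> (nat \<Rightarrow> nat \<Rightarrow> nat \<Rightarrow> ('n, 'k) mpoly) \<Rightarrow> bool" where
  "minimal_graded_free_resolution I r dg phi \<longleftrightarrow>
     graded_free_resolution I r dg phi \<and>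
     (\<forall>i\<ge>1. \<forall>j<r (i-1). \<forall>l<r i. Poly_Mapping.lookup (phi i j l) 0 = 0)"

definition fq :: "nat \<Rightarrow> real \<Rightarrow> real" where
  "fq m q = (\<Prod>j=1..m. q ^ j - 1)"

definition gauss_binom :: "nat \<Rightarrow> nat \<Rightarrow> real \<Rightarrow> real" where
  "gauss_binom k i q = fq k q / (fq i q * fq (k - i) q)"

definition has_shape :: "nat \<Rightarrow> nat \<Rightarrow> nat \<Rightarrow> (nat \<Rightarrow> nat) \<Rightarrow> (nat \<Rightarrow> nat \<Rightarrow> int) \<Rightarrow> bool" where
  "has_shape q k d r dg \<longleftrightarrow>
     (\<forall>i. 1 \<le> i \<and> i \<le> k \<longrightarrow>
        real (r i) = gauss_binom k i (real q) * real q ^ (i * (i - 1) div 2) \<and>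
        (\<forall>l<r i. real_of_int (dg i l) =
            real d * (real q ^ i - 1) / (real q ^ (i - 1) * (real q - 1)))) \<and>
     (\<forall>i>k. r i = 0)"

end

theory Submission
  imports Defs
begin

text \<open>A flag of subcodes \<open>0 = V\<^sub>0 \<subset> \<dots> \<subset> V\<^sub>k = C\<close> with vectors \<open>b\<^sub>j \<in> V\<^sub>j\<^sub>+\<^sub>1 - V\<^sub>j\<close> gives one normalized codeword
  in \<open>b\<^sub>j + V\<^sub>j\<close> for every line of \<open>V\<^sub>j\<^sub>+\<^sub>1\<close> not contained in \<open>V\<^sub>j\<close>. The supports of these codewords generate the
  Stanley-Reisner ideal. Consider the simplicial complex whose faces contain at most one
  codeword from each layer \<open>b\<^sub>j + V\<^sub>j\<close>, labelled by the unions of supports. The part supported in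
  a given multidegree consists of the vertices in a subcode \<open>W\<close>; the smallest layer meeting \<open>W\<close>
  meets it in a single vertex, so that part is a cone and the complex supports a cellular
  resolution. A face with \<open>i\<close> elements spans an \<open>i\<close>-dimensional subcode, whose support size follows
  from double counting; this gives the degrees \<open>d\<^sub>i\<close> and also minimality. The number of such
  faces is the \<open>i\<close>-th elementary symmetric function of \<open>1, q, \<dots>, q\<^sup>k\<^sup>-\<^sup>1\<close>. Every other minimal
  resolution has the same shape because comparison maps are inverse up to homotopy.\<close>

section \<open>Linear algebra: more unknowns than equations\<close>

lemma underdetermined_nontrivial_solution:
  fixes A :: "'i \<Rightarrow> 'j \<Rightarrow> 'k::field"
  assumes "finite J" "finite L" "card J < card L"
  shows "\<exists>x. (\<exists>l\<in>L. x l \<noteq> 0) \<and> (\<forall>j\<in>J. (\<Sum>l\<in>L. A j l * x l) = 0)"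
  using assms
proof (induction J arbitrary: A L rule: finite_induct)
  case empty
  then obtain l where "l \<in> L" by (metis card_eq_0_iff ex_in_conv less_nat_zero_code card.empty)
  then show ?case by (intro exI[of _ "\<lambda>_. 1"]) auto
next
  case (insert j J)
  show ?case
  proof (cases "\<forall>l\<in>L. A j l = 0")
    case True
    obtain x where "\<exists>l\<in>L. x l \<noteq> 0" "\<forall>i\<in>J. (\<Sum>l\<in>L. A i l * x l) = 0"
      using insert.IH[of L A] insert.prems insert.hyps by auto
    with True show ?thesis by (intro exI[of _ x]) auto
  next
    case False
    then obtain p where p: "p \<in> L" "A j p \<noteq> 0" by auto
    let ?L = "L - {p}"
    \<comment> \<open>Gaussian elimination with pivot \<open>A j p\<close>: subtracting
      \<open>A i p / A j p\<close> times row \<open>j\<close> from row \<open>i\<close> makes the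
      unknown \<open>p\<close> disappear.\<close>
    define A' where "A' i l = A i l - A i p * A j l / A j p" for i l
    have "card J < card ?L" using insert.prems insert.hyps p by simp
    then obtain x where x: "\<exists>l\<in>?L. x l \<noteq> 0" "\<forall>i\<in>J. (\<Sum>l\<in>?L. A' i l * x l) = 0"
      using insert.IH[of ?L A'] insert.prems by auto
    \<comment> \<open>The value at \<open>p\<close> is the one that makes equation \<open>j\<close>
      hold. No other coordinate changes, so the solution stays nonzero.\<close>
    define y where "y = x(p := - (\<Sum>l\<in>?L. A j l * x l) / A j p)"
    have split: "(\<Sum>l\<in>L. A i l * y l) = A i p * y p + (\<Sum>l\<in>?L. A i l * x l)" for i
      using p insert.prems by (subst sum.remove[of L p]) (auto simp: y_def intro!: sum.cong)
    have "(\<Sum>l\<in>L. A i l * y l) = 0" if "i \<in> J" for i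
    proof -
      have "0 = (\<Sum>l\<in>?L. A' i l * x l)" using x that by simp
      also have "\<dots> = (\<Sum>l\<in>?L. A i l * x l) - (\<Sum>l\<in>?L. A i p / A j p * (A j l * x l))"
        by (simp add: A'_def left_diff_distrib sum_subtractf mult.assoc)
      also have "\<dots> = (\<Sum>l\<in>?L. A i l * x l) - A i p / A j p * (\<Sum>l\<in>?L. A j l * x l)"
        by (simp only: sum_distrib_left)
      also have "\<dots> = (\<Sum>l\<in>L. A i l * y l)"
        by (simp add: split) (simp add: y_def)
      finally show ?thesis by simp
    qed
    moreover have "(\<Sum>l\<in>L. A j l * y l) = 0"
      using p by (simp add: split) (simp add: y_def)
    moreover have "\<exists>l\<in>L. y l \<noteq> 0" using x(1) by (auto simp: y_def)
    ultimately show ?thesis by (intro exI[of _ y]) auto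
  qed
qed

section \<open>Polynomials: constant terms, total degree and homogeneous parts\<close>

lemma lookup_times_zero_exponent:
  fixes p q :: "('n, 'k::comm_ring_1) mpoly"
  shows "Poly_Mapping.lookup (p * q) 0 = Poly_Mapping.lookup p 0 * Poly_Mapping.lookup q 0"
proof -
  let ?L = Poly_Mapping.lookup
  \<comment> \<open>Exponents are natural numbers, so nothing cancels in a sum of exponent
    vectors.\<close>
  have zero: "a = 0 \<and> b = 0" if "a + b = 0" for a b :: "'n \<Rightarrow>\<^sub>0 nat"
  proof -
    have "?L a x + ?L b x = 0" for x using that by (metis lookup_add lookup_zero)
    then show ?thesis by (auto intro!: poly_mapping_eqI)
  qed
  have key: "?L (u * v) 0 = 0" if "?L u 0 = 0 \<or> ?L v 0 = 0" for u v :: "('n, 'k) mpoly"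
  proof (rule ccontr)
    assume "?L (u * v) 0 \<noteq> 0"
    then have "0 \<in> Poly_Mapping.keys (u * v)" by (simp add: in_keys_iff)
    then obtain a b where "a \<in> Poly_Mapping.keys u" "b \<in> Poly_Mapping.keys v" "a + b = 0"
      using keys_mult[of u v] by force
    with zero[of a b] that show False by (auto simp: in_keys_iff)
  qed
  \<comment> \<open>After the constant terms are split off, every product that involves a remainder
    has no constant term, by \<open>key\<close>.\<close>
  define p' q' where "p' = p - Poly_Mapping.single 0 (?L p 0)" and "q' = q - Poly_Mapping.single 0 (?L q 0)"
  have "?L p' 0 = 0" "?L q' 0 = 0" by (simp_all add: p'_def q'_def lookup_minus)
  have "p * q = p * q' + p' * Poly_Mapping.single 0 (?L q 0)
      + Poly_Mapping.single 0 (?L p 0) * Poly_Mapping.single 0 (?L q 0)"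
    by (simp add: p'_def q'_def algebra_simps)
  then show ?thesis
    using key \<open>?L p' 0 = 0\<close> \<open>?L q' 0 = 0\<close> by (simp add: lookup_add mult_single)
qed

lemma total_deg_add:
  fixes a b :: "'n::finite \<Rightarrow>\<^sub>0 nat"
  shows "total_deg (a + b) = total_deg a + total_deg b"
proof -
  have "total_deg m = (\<Sum>x\<in>UNIV. Poly_Mapping.lookup m x)" for m :: "'n \<Rightarrow>\<^sub>0 nat"
    unfolding total_deg_def by (rule sum.mono_neutral_left) (auto simp: in_keys_iff)
  then show ?thesis by (simp add: lookup_add sum.distrib)
qed

definition homogeneous_part :: "int \<Rightarrow> ('n, 'k::zero) mpoly \<Rightarrow> ('n, 'k) mpoly" where
  "homogeneous_part e p = Poly_Mapping.mapp (\<lambda>m c. if int (total_deg m) = e then c else 0) p"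

lemma lookup_homogeneous_part:
  "Poly_Mapping.lookup (homogeneous_part e p) m
    = (if int (total_deg m) = e then Poly_Mapping.lookup p m else 0)"
  by (auto simp: homogeneous_part_def lookup_mapp when_def in_keys_iff)

lemma homogeneous_of_iff:
  "homogeneous_of e p \<longleftrightarrow> (\<forall>m. Poly_Mapping.lookup p m \<noteq> 0 \<longrightarrow> int (total_deg m) = e)"
  by (auto simp: homogeneous_of_def in_keys_iff)

lemma homogeneous_homogeneous_part: "homogeneous_of e (homogeneous_part e p)"
  by (simp add: homogeneous_of_iff lookup_homogeneous_part)

lemma homogeneous_part_id: "homogeneous_of e p \<Longrightarrow> homogeneous_part e p = p"
  by (rule poly_mapping_eqI) (auto simp: homogeneous_of_iff lookup_homogeneous_part)

lemma homogeneous_part_sum: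
  "homogeneous_part e (\<Sum>x\<in>A. f x) = (\<Sum>x\<in>A. homogeneous_part e (f x))"
  by (rule poly_mapping_eqI) (simp add: lookup_homogeneous_part Poly_Mapping.lookup_sum)

lemma homogeneous_of_sum:
  "(\<And>x. x \<in> A \<Longrightarrow> homogeneous_of e (f x)) \<Longrightarrow> homogeneous_of e (\<Sum>x\<in>A. f x)"
  unfolding homogeneous_of_iff Poly_Mapping.lookup_sum by (metis sum.neutral)

lemma homogeneous_of_mult:
  fixes p q :: "('n::finite, 'k::comm_ring_1) mpoly"
  assumes "homogeneous_of a p" "homogeneous_of b q"
  shows "homogeneous_of (a + b) (p * q)"
  unfolding homogeneous_of_def
proof
  fix m assume "m \<in> Poly_Mapping.keys (p * q)"
  then obtain x y where "x \<in> Poly_Mapping.keys p" "y \<in> Poly_Mapping.keys q" "m = x + y"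
    using keys_mult[of p q] by force
  with assms show "int (total_deg m) = a + b" by (auto simp: homogeneous_of_def total_deg_add)
qed

text \<open>Terms of \<open>g\<close> outside degree \<open>e - a\<close> end up outside degree
  \<open>e\<close> after multiplication by \<open>f\<close>. This allows preimages under graded maps
  to be replaced by homogeneous ones.\<close>

lemma homogeneous_part_mult:
  fixes f g :: "('n::finite, 'k::comm_ring_1) mpoly"
  assumes f: "homogeneous_of a f"
  shows "homogeneous_part e (f * g) = f * homogeneous_part (e - a) g"
proof (rule poly_mapping_eqI)
  fix m
  let ?h = "homogeneous_part (e - a) g"
  let ?L = Poly_Mapping.lookup
  have hom: "homogeneous_of e (f * ?h)"
    using homogeneous_of_mult[OF f homogeneous_homogeneous_part[of "e - a" g]] by simp
  have "?L (f * (g - ?h)) m = 0" if deg: "int (total_deg m) = e"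
  proof (rule ccontr)
    assume "?L (f * (g - ?h)) m \<noteq> 0"
    then have "m \<in> Poly_Mapping.keys (f * (g - ?h))" by (simp add: in_keys_iff)
    then obtain x y where "x \<in> Poly_Mapping.keys f" "y \<in> Poly_Mapping.keys (g - ?h)" "m = x + y"
      using keys_mult[of f "g - ?h"] by force
    with f deg show False
      by (auto simp: homogeneous_of_def total_deg_add in_keys_iff lookup_minus
            lookup_homogeneous_part split: if_splits)
  qed
  moreover have "?L (f * g) m = ?L (f * (g - ?h)) m + ?L (f * ?h) m"
    by (simp add: lookup_add[symmetric] distrib_left[symmetric])
  ultimately show "?L (homogeneous_part e (f * g)) m = ?L (f * ?h) m"
    using hom by (auto simp: lookup_homogeneous_part homogeneous_of_iff)
qed

section \<open>Matrices as maps of free modules\<close>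

lemma mat_apply_compose:
  "mat_apply a b A (mat_apply b c B v) = mat_apply a c (\<lambda>j l. \<Sum>m<b. A j m * B m l) v"
  unfolding mat_apply_def
  by (auto simp: fun_eq_iff sum_distrib_left sum_distrib_right mult.assoc intro: sum.swap)

lemma mat_apply_diff:
  "mat_apply a c (\<lambda>j l. A j l - B j l) v = (\<lambda>j. mat_apply a c A v j - mat_apply a c B v j)"
  by (auto simp: mat_apply_def left_diff_distrib sum_subtractf)

lemma mat_apply_diff_right:
  "mat_apply a c A (\<lambda>j. u j - v j) = (\<lambda>j. mat_apply a c A u j - mat_apply a c A v j)"
  by (auto simp: mat_apply_def right_diff_distrib sum_subtractf)

lemma mat_apply_cong:
  "(\<And>l. l < c \<Longrightarrow> u l = v l) \<Longrightarrow> mat_apply a c A u = mat_apply a c A v"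
  by (auto simp: mat_apply_def intro!: sum.cong)

lemma mat_apply_zero [simp]: "mat_apply a c A (\<lambda>_. 0) = (\<lambda>_. 0)"
  by (auto simp: mat_apply_def)

lemma mat_apply_in_fvecs: "mat_apply a c A v \<in> fvecs a"
  by (auto simp: mat_apply_def fvecs_def)

definition unit_vec :: "nat \<Rightarrow> nat \<Rightarrow> 'a::zero_neq_one" where
  "unit_vec l = (\<lambda>j. if j = l then 1 else 0)"

lemma mat_apply_unit_vec:
  "l < c \<Longrightarrow> mat_apply a c A (unit_vec l) = (\<lambda>j. if j < a then A j l else 0)"
  by (auto simp: mat_apply_def unit_vec_def if_distrib cong: if_cong)

text \<open>By linearity a map is determined by its columns, so two maps need only be compared on
  unit vectors.\<close>

lemma mat_apply_expand:
  "mat_apply a c A v = (\<lambda>j. \<Sum>l<c. mat_apply a c A (unit_vec l) j * v l)"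
  by (auto simp: mat_apply_unit_vec fun_eq_iff) (auto simp: mat_apply_def)

section \<open>Comparison of graded free resolutions\<close>

text \<open>In degree 0 the kernel of the augmentation S -> S/I takes the place of the kernel of a
  differential. The augmentation condition and exactness in positive degrees then become the single
  statement \<open>cycles_eq_boundaries\<close>.\<close>

definition cycles :: "('n::finite, 'k::field) mpoly set \<Rightarrow> (nat \<Rightarrow> nat)
    \<Rightarrow> (nat \<Rightarrow> nat \<Rightarrow> nat \<Rightarrow> ('n, 'k) mpoly) \<Rightarrow> nat \<Rightarrow> (nat \<Rightarrow> ('n, 'k) mpoly) set" where
  "cycles I r phi i = {v \<in> fvecs (r i).
     if i = 0 then v 0 \<in> I else mat_apply (r (i - 1)) (r i) (phi i) v = (\<lambda>_. 0)}"

abbreviation differential :: "(nat \<Rightarrow> nat) \<Rightarrow> (nat \<Rightarrow> nat \<Rightarrow> nat \<Rightarrow> ('n::finite, 'k::field) mpoly)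
    \<Rightarrow> nat \<Rightarrow> (nat \<Rightarrow> ('n, 'k) mpoly) \<Rightarrow> (nat \<Rightarrow> ('n, 'k) mpoly)" where
  "differential r phi i \<equiv> mat_apply (r i) (r (Suc i)) (phi (Suc i))"

lemma cycles_Suc:
  "v \<in> cycles I r phi (Suc i) \<longleftrightarrow> v \<in> fvecs (r (Suc i)) \<and> differential r phi i v = (\<lambda>_. 0)"
  by (auto simp: cycles_def)

lemma cycles_eq_boundaries:
  assumes "graded_free_resolution I r dg phi"
  shows "cycles I r phi i = differential r phi i ` fvecs (r (Suc i))"
proof (cases "i = 0")
  case True
  have r0: "r 0 = 1" and I: "(\<lambda>v. differential r phi 0 v 0) ` fvecs (r 1) = I"
    using assms by (auto simp: graded_free_resolution_def)
  have "v = differential r phi 0 u" if "v \<in> fvecs 1" "v 0 = differential r phi 0 u 0" for u v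
    using that by (auto simp: fun_eq_iff mat_apply_def fvecs_def r0 gr0_conv_Suc)
  moreover have "differential r phi 0 u \<in> fvecs 1" for u
    using mat_apply_in_fvecs[of "r 0"] by (simp add: r0)
  ultimately show ?thesis
    using True I r0 by (fastforce simp: cycles_def)
next
  case False
  then show ?thesis using assms by (auto simp: graded_free_resolution_def cycles_def)
qed

lemma differential_in_cycles:
  assumes "graded_free_resolution I r dg phi"
  shows "differential r phi i u \<in> cycles I r phi i"
proof -
  \<comment> \<open>The given \<open>u\<close> may be nonzero beyond the rank.
    \<open>mat_apply\<close> ignores those entries, so they are cut off to land in
    \<open>fvecs\<close>.\<close>
  define u' where "u' = (\<lambda>l. if l < r (Suc i) then u l else 0)"
  have "differential r phi i u = differential r phi i u'"
    by (rule mat_apply_cong) (simp add: u'_def)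
  moreover have "u' \<in> fvecs (r (Suc i))" by (simp add: u'_def fvecs_def)
  ultimately show ?thesis using cycles_eq_boundaries[OF assms, of i] by auto
qed

lemma differential_homogeneous:
  assumes "graded_free_resolution I r dg phi" "j < r i" "l < r (Suc i)"
  shows "homogeneous_of (dg (Suc i) l - dg i j) (phi (Suc i) j l)"
proof -
  have "\<forall>i\<ge>1. \<forall>j<r (i - 1). \<forall>l<r i. homogeneous_of (dg i l - dg (i - 1) j) (phi i j l)"
    using assms(1) by (simp add: graded_free_resolution_def)
  from this[rule_format, of "Suc i"] assms(2,3) show ?thesis by simp
qed

text \<open>Exactness gives some preimage. If \<open>v\<close> has degree \<open>e\<close> in the
  graded module, its entry \<open>j\<close> has degree \<open>e - dg i j\<close>, and keeping only
  the part of matching degree in each entry of the preimage does not change the image.\<close>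

lemma lift_cycle:
  assumes res: "graded_free_resolution I r dg phi" and v: "v \<in> cycles I r phi i"
  shows "\<exists>u. differential r phi i u = v
    \<and> ((\<forall>j<r i. homogeneous_of (e - dg i j) (v j))
        \<longrightarrow> (\<forall>j<r (Suc i). homogeneous_of (e - dg (Suc i) j) (u j)))"
proof -
  obtain u where u: "differential r phi i u = v"
    using v cycles_eq_boundaries[OF res, of i] by auto
  show ?thesis
  proof (cases "\<forall>j<r i. homogeneous_of (e - dg i j) (v j)")
    case True
    define u' where "u' l = homogeneous_part (e - dg (Suc i) l) (u l)" for l
    have "differential r phi i u' j = v j" for j
    proof (cases "j < r i")
      case j: True
      have "v j = homogeneous_part (e - dg i j) (differential r phi i u j)"
        using True j u by (simp add: homogeneous_part_id)
      also have "\<dots> = differential r phi i u' j"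
        using j by (simp add: mat_apply_def u'_def homogeneous_part_sum homogeneous_part_mult[OF differential_homogeneous[OF res]])
      finally show ?thesis ..
    next
      case False
      then show ?thesis using v by (auto simp: mat_apply_def cycles_def fvecs_def)
    qed
    then show ?thesis
      by (intro exI[of _ u']) (auto simp: u'_def homogeneous_homogeneous_part)
  qed (use u in auto)
qed

text \<open>Free modules are projective: lifts of the images of the basis vectors are the columns of
  \<open>N\<close>. Here \<open>e l\<close> is the degree of generator \<open>l\<close> of the
  source.\<close>

lemma lift_matrix:
  assumes res: "graded_free_resolution I r dg phi"
    and cyc: "\<And>l. l < c \<Longrightarrow> mat_apply (r i) c M (unit_vec l) \<in> cycles I r phi i"
  shows "\<exists>N. (\<forall>v. differential r phi i (mat_apply (r (Suc i)) c N v) = mat_apply (r i) c M v)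
    \<and> ((\<forall>j<r i. \<forall>l<c. homogeneous_of (e l - dg i j) (M j l))
        \<longrightarrow> (\<forall>j<r (Suc i). \<forall>l<c. homogeneous_of (e l - dg (Suc i) j) (N j l)))"
proof -
  have "\<exists>u. differential r phi i u = mat_apply (r i) c M (unit_vec l)
    \<and> ((\<forall>j<r i. homogeneous_of (e l - dg i j) (M j l))
        \<longrightarrow> (\<forall>j<r (Suc i). homogeneous_of (e l - dg (Suc i) j) (u j)))" if "l < c" for l
    using lift_cycle[OF res cyc[OF that], of "e l"] that by (simp add: mat_apply_unit_vec)
  then obtain u where u: "\<And>l. l < c \<Longrightarrow> differential r phi i (u l) = mat_apply (r i) c M (unit_vec l)"
    "\<And>l. l < c \<Longrightarrow> (\<forall>j<r i. homogeneous_of (e l - dg i j) (M j l))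
        \<longrightarrow> (\<forall>j<r (Suc i). homogeneous_of (e l - dg (Suc i) j) (u l j))"
    by metis
  define N where "N j l = u l j" for j l
  have "differential r phi i (mat_apply (r (Suc i)) c N v) = mat_apply (r i) c M v" for v
  proof -
    let ?P = "\<lambda>j l. \<Sum>m<r (Suc i). phi (Suc i) j m * N m l"
    have "mat_apply (r i) c ?P (unit_vec l) = mat_apply (r i) c M (unit_vec l)" if "l < c" for l
      using u(1)[OF that] that
      by (simp only: mat_apply_unit_vec) (simp add: N_def mat_apply_def fun_eq_iff, metis)
    then show ?thesis
      unfolding mat_apply_compose
      by (subst (1 2) mat_apply_expand) simp
  qed
  with u(2) show ?thesis by (intro exI[of _ N]) (auto simp: N_def)
qed

text \<open>The identity of S/I is lifted to a graded chain map, one homological degree after the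
  other.\<close>

lemma comparison_map:
  assumes res: "graded_free_resolution I r dg phi" and res': "graded_free_resolution I r' dg' phi'"
  obtains \<alpha> where "\<alpha> 0 = (\<lambda>_ _. 1)"
    "\<And>i j l. j < r' i \<Longrightarrow> l < r i \<Longrightarrow> homogeneous_of (dg i l - dg' i j) (\<alpha> i j l)"
    "\<And>i v. differential r' phi' i (mat_apply (r' (Suc i)) (r (Suc i)) (\<alpha> (Suc i)) v)
        = mat_apply (r' i) (r i) (\<alpha> i) (differential r phi i v)"
proof -
  define hom where "hom i A \<longleftrightarrow> (\<forall>j<r' i. \<forall>l<r i. homogeneous_of (dg i l - dg' i j) (A j l))"
    for i and A :: "nat \<Rightarrow> nat \<Rightarrow> ('a, 'b) mpoly"
  \<comment> \<open>\<open>P\<close> is the invariant in a single degree, including that cycles go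
    to cycles; \<open>Q\<close> is the commuting square between consecutive degrees.\<close>
  define P where "P i A \<longleftrightarrow> (i = 0 \<longrightarrow> A = (\<lambda>_ _. 1)) \<and> hom i A
      \<and> (\<forall>v\<in>cycles I r phi i. mat_apply (r' i) (r i) A v \<in> cycles I r' phi' i)" for i A
  define Q where "Q i A B \<longleftrightarrow> (\<forall>v. differential r' phi' i (mat_apply (r' (Suc i)) (r (Suc i)) B v)
        = mat_apply (r' i) (r i) A (differential r phi i v))" for i A B
  have r0: "r 0 = 1" "r' 0 = 1" "dg 0 0 = 0" "dg' 0 0 = 0"
    using res res' by (auto simp: graded_free_resolution_def)
  have "hom 0 (\<lambda>_ _. 1)"
    by (auto simp: hom_def homogeneous_of_iff r0 lookup_one when_def total_deg_def)
  then have "\<exists>A. P 0 A"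
    by (intro exI[of _ "\<lambda>_ _. 1"]) (auto simp: P_def cycles_def r0 mat_apply_def fvecs_def)
  moreover have "\<exists>B. P (Suc i) B \<and> Q i A B" if A: "P i A" for A i
  proof -
    \<comment> \<open>The next differential followed by \<open>A\<close>. Its columns are cycles by
      \<open>P\<close>, so they can be lifted.\<close>
    let ?M = "\<lambda>j l. \<Sum>m<r i. A j m * phi (Suc i) m l"
    have M: "mat_apply (r' i) (r (Suc i)) ?M v = mat_apply (r' i) (r i) A (differential r phi i v)" for v
      by (simp only: mat_apply_compose)
    have "mat_apply (r' i) (r (Suc i)) ?M (unit_vec l) \<in> cycles I r' phi' i" for l
      using A differential_in_cycles[OF res] by (auto simp: M P_def)
    from lift_matrix[where e = "dg (Suc i)" and c = "r (Suc i)", OF res' this] obtain B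
      where B: "\<And>v. differential r' phi' i (mat_apply (r' (Suc i)) (r (Suc i)) B v)
          = mat_apply (r' i) (r (Suc i)) ?M v"
        "(\<forall>j<r' i. \<forall>l<r (Suc i). homogeneous_of (dg (Suc i) l - dg' i j) (?M j l)) \<longrightarrow> hom (Suc i) B"
      unfolding hom_def by blast
    have "homogeneous_of (dg (Suc i) l - dg' i j) (?M j l)" if "j < r' i" "l < r (Suc i)" for j l
    proof (rule homogeneous_of_sum)
      fix m assume "m \<in> {..<r i}"
      then have "homogeneous_of (dg i m - dg' i j) (A j m)"
        "homogeneous_of (dg (Suc i) l - dg i m) (phi (Suc i) m l)"
        using A that differential_homogeneous[OF res, of m i l] by (auto simp: P_def hom_def)
      from homogeneous_of_mult[OF this]
      show "homogeneous_of (dg (Suc i) l - dg' i j) (A j m * phi (Suc i) m l)" by simp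
    qed
    then have "hom (Suc i) B" using B(2) by blast
    moreover have "Q i A B" unfolding Q_def using B(1) M by metis
    ultimately have "P (Suc i) B"
      unfolding P_def Q_def by (auto simp: mat_apply_in_fvecs cycles_Suc)
    with \<open>Q i A B\<close> show ?thesis by blast
  qed
  ultimately obtain \<alpha> where "\<forall>i. P i (\<alpha> i) \<and> Q i (\<alpha> i) (\<alpha> (Suc i))"
    using dependent_nat_choice[of P Q] by blast
  then show ?thesis by (intro that[of \<alpha>]) (auto simp: P_def Q_def hom_def)
qed

text \<open>A chain endomorphism that is zero in degree 0 is null-homotopic, so each
  \<open>G (Suc i)\<close> is a sum of two products, each with a differential as a factor. By
  minimality the entries of the differentials have no constant term, hence neither do those of
  \<open>G\<close>.\<close>

lemma null_homotopy_constant_terms: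
  assumes minres: "minimal_graded_free_resolution I r dg phi"
    and G0: "\<And>v. mat_apply (r 0) (r 0) (G 0) v = (\<lambda>_. 0)"
    and G: "\<And>i v. differential r phi i (mat_apply (r (Suc i)) (r (Suc i)) (G (Suc i)) v)
        = mat_apply (r i) (r i) (G i) (differential r phi i v)"
    and jl: "j < r (Suc i)" "l < r (Suc i)"
  shows "Poly_Mapping.lookup (G (Suc i) j l) 0 = 0"
proof -
  have res: "graded_free_resolution I r dg phi"
    using minres by (simp add: minimal_graded_free_resolution_def)
  have const: "Poly_Mapping.lookup (phi (Suc i) j l) 0 = 0" if "j < r i" "l < r (Suc i)" for i j l
    using minres that unfolding minimal_graded_free_resolution_def
    by (metis diff_Suc_1 le_add1 plus_1_eq_Suc)
  \<comment> \<open>On cycles the homotopy identity loses its second summand. The condition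
    therefore mentions only the newest homotopy map and can be carried through the
    induction.\<close>
  define htpy where "htpy i s \<longleftrightarrow> (\<forall>v\<in>cycles I r phi i. mat_apply (r i) (r i) (G i) v
      = differential r phi i (mat_apply (r (Suc i)) (r i) s v))" for i s
  have step: "\<exists>N. htpy (Suc i) N \<and>
      (\<forall>j<r (Suc i). \<forall>l<r (Suc i). Poly_Mapping.lookup (G (Suc i) j l) 0 = 0)" if s: "htpy i s" for i s
  proof -
    \<comment> \<open>The part of \<open>G (Suc i)\<close> that \<open>s\<close> does not account
      for. It takes values in cycles and so factors through the next differential.\<close>
    let ?M = "\<lambda>j l. G (Suc i) j l - (\<Sum>m<r i. s j m * phi (Suc i) m l)"
    let ?n = "r (Suc i)"
    have M: "mat_apply ?n ?n ?M v = (\<lambda>j. mat_apply ?n ?n (G (Suc i)) v j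
        - mat_apply ?n (r i) s (differential r phi i v) j)" for v
      by (simp only: mat_apply_compose mat_apply_diff)
    have "differential r phi i (mat_apply ?n ?n ?M v) = (\<lambda>_. 0)" for v
      unfolding M mat_apply_diff_right
      using s differential_in_cycles[OF res] by (simp add: G htpy_def)
    then have "mat_apply ?n ?n ?M (unit_vec l) \<in> cycles I r phi (Suc i)" for l
      unfolding cycles_Suc using mat_apply_in_fvecs by blast
    from lift_matrix[where c = ?n, OF res this] obtain N
      where N: "\<And>v. differential r phi (Suc i) (mat_apply (r (Suc (Suc i))) ?n N v) = mat_apply ?n ?n ?M v"
      by blast
    have "htpy (Suc i) N"
      unfolding htpy_def N M by (auto simp: cycles_Suc)
    moreover have "Poly_Mapping.lookup (G (Suc i) j l) 0 = 0" if "j < ?n" "l < ?n" for j l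
    proof -
      have "?M j l = (\<Sum>m<r (Suc (Suc i)). phi (Suc (Suc i)) j m * N m l)"
        using fun_cong[OF N[of "unit_vec l"], of j] that
        by (simp only: mat_apply_unit_vec[OF that(2)] if_True) (simp add: mat_apply_def)
      then have "G (Suc i) j l = (\<Sum>m<r (Suc (Suc i)). phi (Suc (Suc i)) j m * N m l)
          + (\<Sum>m<r i. s j m * phi (Suc i) m l)"
        by (simp add: algebra_simps)
      then show ?thesis
        using that by (simp add: lookup_add Poly_Mapping.lookup_sum lookup_times_zero_exponent const)
    qed
    ultimately show ?thesis by blast
  qed
  have "mat_apply a c (\<lambda>_ _. 0) v = (\<lambda>_. 0)" for a c and v :: "nat \<Rightarrow> ('a, 'b) mpoly"
    by (auto simp: mat_apply_def)
  then have "htpy 0 (\<lambda>_ _. 0)" by (simp add: htpy_def G0)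
  then have "\<exists>s. htpy i s" for i by (induction i) (use step in blast)+
  then show ?thesis using step jl by blast
qed

text \<open>The composite of comparison maps there and back is homotopic to the identity, so its
  constant terms form an identity matrix factoring through a space of dimension \<open>r' i\<close>.\<close>

lemma minimal_resolution_ranks_le:
  assumes min: "minimal_graded_free_resolution I r dg phi"
    and res': "graded_free_resolution I r' dg' phi'"
  shows "r i \<le> r' i" and "l < r i \<Longrightarrow> \<exists>j<r' i. dg i l = dg' i j"
proof -
  have res: "graded_free_resolution I r dg phi"
    using min by (simp add: minimal_graded_free_resolution_def)
  obtain \<alpha> where \<alpha>: "\<alpha> 0 = (\<lambda>_ _. 1)"
    "\<And>i j l. j < r' i \<Longrightarrow> l < r i \<Longrightarrow> homogeneous_of (dg i l - dg' i j) (\<alpha> i j l)"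
    "\<And>i v. differential r' phi' i (mat_apply (r' (Suc i)) (r (Suc i)) (\<alpha> (Suc i)) v)
        = mat_apply (r' i) (r i) (\<alpha> i) (differential r phi i v)"
    by (rule comparison_map[OF res res']) blast
  obtain \<beta> where \<beta>: "\<beta> 0 = (\<lambda>_ _. 1)"
    "\<And>i v. differential r phi i (mat_apply (r (Suc i)) (r' (Suc i)) (\<beta> (Suc i)) v)
        = mat_apply (r i) (r' i) (\<beta> i) (differential r' phi' i v)"
    by (rule comparison_map[OF res' res]) blast
  have r0: "r 0 = 1" "r' 0 = 1" using res res' by (auto simp: graded_free_resolution_def)
  \<comment> \<open>The failure of \<open>\<beta>\<close> after \<open>\<alpha>\<close> to be the
    identity. It vanishes in degree 0 and commutes with the differentials, so none of its entries
    has a constant term.\<close>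
  define G where "G i j l = (\<Sum>m<r' i. \<beta> i j m * \<alpha> i m l) - (if j = l then 1 else 0)" for i j l
  have id: "mat_apply n n (\<lambda>j l. if j = l then 1 else 0) v = (\<lambda>j. if j < n then v j else 0)"
    for n and v :: "nat \<Rightarrow> ('a, 'b) mpoly"
    by (auto simp: mat_apply_def fun_eq_iff if_distrib[of "\<lambda>x. x * _"] cong: if_cong)
  have G: "mat_apply (r i) (r i) (G i) v
      = (\<lambda>j. mat_apply (r i) (r' i) (\<beta> i) (mat_apply (r' i) (r i) (\<alpha> i) v) j - (if j < r i then v j else 0))" for i v
    unfolding G_def mat_apply_diff mat_apply_compose id ..
  have "Poly_Mapping.lookup (G i j l) 0 = 0" if "j < r i" "l < r i" for j l
  proof (cases i)
    case 0
    then show ?thesis using that by (simp add: G_def r0 \<alpha>(1) \<beta>(1))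
  next
    case (Suc i')
    have "Poly_Mapping.lookup (G (Suc i') j l) 0 = 0"
    proof (rule null_homotopy_constant_terms[OF min])
      show "mat_apply (r 0) (r 0) (G 0) v = (\<lambda>_. 0)" for v
        by (auto simp: G_def r0 \<alpha>(1) \<beta>(1) mat_apply_def)
      show "differential r phi i (mat_apply (r (Suc i)) (r (Suc i)) (G (Suc i)) v)
        = mat_apply (r i) (r i) (G i) (differential r phi i v)" for i v
      proof -
        have "differential r phi i (\<lambda>j. if j < r (Suc i) then v j else 0) = differential r phi i v"
          by (rule mat_apply_cong) simp
        moreover have "differential r phi i v = (\<lambda>j. if j < r i then differential r phi i v j else 0)"
          by (auto simp: mat_apply_def)
        ultimately show ?thesis
          by (simp only: G mat_apply_diff_right \<alpha>(3) \<beta>(2)) (simp add: mat_apply_def)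
      qed
    qed (use that Suc in auto)
    then show ?thesis by (simp add: Suc)
  qed
  then have BA: "(\<Sum>m<r' i. Poly_Mapping.lookup (\<beta> i j m) 0 * Poly_Mapping.lookup (\<alpha> i m l) 0)
      = (if j = l then 1 else 0)" if "j < r i" "l < r i" for j l
    using that unfolding G_def
    by (simp add: lookup_minus Poly_Mapping.lookup_sum lookup_times_zero_exponent split: if_splits)
  show "r i \<le> r' i"
  proof (rule ccontr)
    \<comment> \<open>Otherwise the constant terms of \<open>\<alpha>\<close> kill a nonzero vector,
      which their composite with those of \<open>\<beta>\<close> has to fix.\<close>
    assume "\<not> r i \<le> r' i"
    then obtain x where x: "\<exists>l<r i. x l \<noteq> 0" "\<forall>j<r' i. (\<Sum>l<r i. Poly_Mapping.lookup (\<alpha> i j l) 0 * x l) = 0"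
      using underdetermined_nontrivial_solution[of "{..<r' i}" "{..<r i}" "\<lambda>j l. Poly_Mapping.lookup (\<alpha> i j l) 0"]
      by auto
    have "x j = 0" if j: "j < r i" for j
    proof -
      have "x j = (\<Sum>l<r i. (if j = l then 1 else 0) * x l)"
        using j by (simp add: if_distrib[of "\<lambda>x. x * _"] cong: if_cong)
      also have "\<dots> = (\<Sum>l<r i. \<Sum>m<r' i. Poly_Mapping.lookup (\<beta> i j m) 0 * (Poly_Mapping.lookup (\<alpha> i m l) 0 * x l))"
        by (rule sum.cong) (use BA[OF j] in \<open>simp_all add: sum_distrib_right[symmetric] mult.assoc[symmetric]\<close>)
      also have "\<dots> = (\<Sum>m<r' i. Poly_Mapping.lookup (\<beta> i j m) 0 * (\<Sum>l<r i. Poly_Mapping.lookup (\<alpha> i m l) 0 * x l))"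
        by (subst sum.swap) (simp add: sum_distrib_left)
      also have "\<dots> = 0" using x by simp
      finally show ?thesis .
    qed
    with x show False by blast
  qed
  show "\<exists>j<r' i. dg i l = dg' i j" if l: "l < r i"
  proof -
    \<comment> \<open>A diagonal entry of the identity is 1, so some \<open>\<alpha> i m l\<close>
      has a nonzero constant term. It is homogeneous of degree \<open>dg i l - dg' i m\<close>,
      which must then be 0.\<close>
    have "(\<Sum>m<r' i. Poly_Mapping.lookup (\<beta> i l m) 0 * Poly_Mapping.lookup (\<alpha> i m l) 0) \<noteq> 0"
      by (simp add: BA[OF l l])
    then obtain m where m: "m < r' i" "Poly_Mapping.lookup (\<alpha> i m l) 0 \<noteq> 0"
      by (elim sum.not_neutral_contains_not_neutral) auto
    have "int (total_deg (0 :: 'a \<Rightarrow>\<^sub>0 nat)) = dg i l - dg' i m"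
      using \<alpha>(2)[OF m(1) l] m(2) unfolding homogeneous_of_iff by blast
    with m show ?thesis by (intro exI[of _ m]) (simp add: total_deg_def)
  qed
qed

section \<open>Squarefree monomials\<close>

definition exponent_of :: "'n set \<Rightarrow> ('n \<Rightarrow>\<^sub>0 nat)" where
  "exponent_of A = (\<Sum>i\<in>A. Poly_Mapping.single i 1)"

lemma sqfree_monomial_eq: "sqfree_monomial A = Poly_Mapping.single (exponent_of A) 1"
  by (simp add: sqfree_monomial_def exponent_of_def)

lemma lookup_exponent_of:
  fixes A :: "'n::finite set"
  shows "Poly_Mapping.lookup (exponent_of A) i = (if i \<in> A then 1 else 0)"
  by (simp add: exponent_of_def Poly_Mapping.lookup_sum lookup_single when_def)

lemma total_deg_exponent_of: "total_deg (exponent_of A) = card (A :: 'n::finite set)"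
proof -
  have "Poly_Mapping.keys (exponent_of A) = A"
    by (auto simp: in_keys_iff lookup_exponent_of split: if_splits)
  then show ?thesis by (simp add: total_deg_def lookup_exponent_of)
qed

lemma sqfree_monomial_mult:
  fixes A B :: "'n::finite set"
  assumes "A \<inter> B = {}"
  shows "sqfree_monomial A * sqfree_monomial B = (sqfree_monomial (A \<union> B) :: ('n, 'k::comm_ring_1) mpoly)"
  using assms by (simp add: sqfree_monomial_eq mult_single exponent_of_def sum.union_disjoint)

lemma sqfree_monomial_split:
  fixes A B :: "'n::finite set"
  assumes "A \<subseteq> B"
  shows "sqfree_monomial B = (sqfree_monomial A * sqfree_monomial (B - A) :: ('n, 'k::comm_ring_1) mpoly)"
  using assms by (subst sqfree_monomial_mult) (auto simp: Un_absorb1)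

text \<open>Multiplication by a monomial shifts exponents and loses no coefficient. Identities may
  thus be checked after multiplication by a monomial.\<close>

lemma lookup_sqfree_monomial_mult:
  fixes p :: "('n::finite, 'k::comm_ring_1) mpoly"
  shows "Poly_Mapping.lookup (sqfree_monomial A * p) (exponent_of A + m) = Poly_Mapping.lookup p m"
proof -
  have "p = (\<Sum>x\<in>Poly_Mapping.keys p. Poly_Mapping.single x (Poly_Mapping.lookup p x))"
    by (rule poly_mapping_eqI)
      (auto simp: Poly_Mapping.lookup_sum lookup_single when_def in_keys_iff intro!: sum.neutral)
  then have "sqfree_monomial A * p
      = (\<Sum>x\<in>Poly_Mapping.keys p. Poly_Mapping.single (exponent_of A + x) (Poly_Mapping.lookup p x))"
    by (metis (no_types, lifting) sqfree_monomial_eq mult_single mult_1 sum_distrib_left sum.cong)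
  then show ?thesis
    by (auto simp: Poly_Mapping.lookup_sum lookup_single when_def in_keys_iff)
qed

lemma sqfree_monomial_mult_cancel:
  fixes p q :: "('n::finite, 'k::comm_ring_1) mpoly"
  shows "sqfree_monomial A * p = sqfree_monomial A * q \<longleftrightarrow> p = q"
  by (metis lookup_sqfree_monomial_mult poly_mapping_eqI)

lemma subset_keys_if_sqfree_monomial_mult:
  fixes p :: "('n::finite, 'k::comm_ring_1) mpoly"
  assumes "Poly_Mapping.lookup (sqfree_monomial A * p) m \<noteq> 0"
  shows "A \<subseteq> Poly_Mapping.keys m"
proof -
  have "m \<in> Poly_Mapping.keys (sqfree_monomial A * p)" using assms by (simp add: in_keys_iff)
  then obtain x where "m = exponent_of A + x"
    using keys_mult[of "sqfree_monomial A" p]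
    by (auto simp: sqfree_monomial_eq split: if_splits)
  then show ?thesis by (auto simp: in_keys_iff lookup_add lookup_exponent_of)
qed

text \<open>Every exponent that occurs is at least 1 on \<open>A\<close>, so the truncated
  subtraction of \<open>exponent_of A\<close> is exact.\<close>

lemma sqfree_monomial_dvd:
  fixes p :: "('n::finite, 'k::comm_ring_1) mpoly"
  assumes "\<And>m. Poly_Mapping.lookup p m \<noteq> 0 \<Longrightarrow> A \<subseteq> Poly_Mapping.keys m"
  shows "\<exists>q. p = sqfree_monomial A * q"
proof -
  have "exponent_of A + (m - exponent_of A) = m" if "m \<in> Poly_Mapping.keys p" for m
  proof (rule poly_mapping_eqI)
    fix i
    have "i \<in> A \<Longrightarrow> Poly_Mapping.lookup m i \<noteq> 0"
      using assms[of m] that by (auto simp: in_keys_iff)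
    then show "Poly_Mapping.lookup (exponent_of A + (m - exponent_of A)) i = Poly_Mapping.lookup m i"
      by (auto simp: lookup_add lookup_minus lookup_exponent_of)
  qed
  moreover have "p = (\<Sum>m\<in>Poly_Mapping.keys p. Poly_Mapping.single m (Poly_Mapping.lookup p m))"
    by (rule poly_mapping_eqI)
      (auto simp: Poly_Mapping.lookup_sum lookup_single when_def in_keys_iff intro!: sum.neutral)
  ultimately have "p = sqfree_monomial A * (\<Sum>m\<in>Poly_Mapping.keys p.
      Poly_Mapping.single (m - exponent_of A) (Poly_Mapping.lookup p m))"
    by (simp add: sum_distrib_left sqfree_monomial_eq mult_single)
  then show ?thesis by blast
qed

text \<open>Each non-face contains some \<open>supp v\<close>, and each \<open>supp v\<close> is
  itself a non-face, so the monomials of these supports generate the ideal.\<close>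

lemma SR_ideal_eq_combinations:
  fixes supp :: "'v \<Rightarrow> 'n::finite set"
  assumes fin: "finite V" and \<Delta>: "\<And>\<sigma>. \<sigma> \<notin> \<Delta> \<longleftrightarrow> (\<exists>v\<in>V. supp v \<subseteq> \<sigma>)"
  shows "SR_ideal \<Delta> = range (\<lambda>g. \<Sum>v\<in>V. sqfree_monomial (supp v) * (g v :: ('n, 'k::comm_ring_1) mpoly))"
proof (intro equalityI subsetI)
  fix p :: "('n, 'k) mpoly" assume "p \<in> SR_ideal \<Delta>"
  then obtain f where p: "p = (\<Sum>\<sigma>\<in>{\<sigma>. \<sigma> \<notin> \<Delta>}. f \<sigma> * sqfree_monomial \<sigma>)"
    by (auto simp: SR_ideal_def)
  obtain c where c: "\<And>\<sigma>. \<sigma> \<notin> \<Delta> \<Longrightarrow> c \<sigma> \<in> V \<and> supp (c \<sigma>) \<subseteq> \<sigma>"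
    using \<Delta> by metis
  define g where "g v = (\<Sum>\<sigma>\<in>{\<sigma>\<in>{\<sigma>. \<sigma> \<notin> \<Delta>}. c \<sigma> = v}. f \<sigma> * sqfree_monomial (\<sigma> - supp v))" for v
  have "(\<Sum>v\<in>V. sqfree_monomial (supp v) * g v)
      = (\<Sum>v\<in>V. \<Sum>\<sigma>\<in>{\<sigma>\<in>{\<sigma>. \<sigma> \<notin> \<Delta>}. c \<sigma> = v}. f \<sigma> * sqfree_monomial \<sigma>)"
    unfolding g_def sum_distrib_left
  proof (intro sum.cong refl)
    fix v \<sigma> assume "\<sigma> \<in> {\<sigma> \<in> {\<sigma>. \<sigma> \<notin> \<Delta>}. c \<sigma> = v}"
    then have "supp v \<subseteq> \<sigma>" using c by blast
    then show "sqfree_monomial (supp v) * (f \<sigma> * sqfree_monomial (\<sigma> - supp v)) = f \<sigma> * sqfree_monomial \<sigma>"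
      by (simp add: sqfree_monomial_split[of "supp v" \<sigma>] mult.left_commute)
  qed
  also have "\<dots> = p"
    unfolding p by (rule sum.group) (use fin c in auto)
  finally show "p \<in> range (\<lambda>g. \<Sum>v\<in>V. sqfree_monomial (supp v) * g v)" by blast
next
  fix p :: "('n, 'k) mpoly" assume "p \<in> range (\<lambda>g. \<Sum>v\<in>V. sqfree_monomial (supp v) * g v)"
  then obtain g where p: "p = (\<Sum>v\<in>V. sqfree_monomial (supp v) * g v)" by blast
  \<comment> \<open>Different elements of \<open>V\<close> may share a support, so their
    coefficients are collected.\<close>
  define f where "f \<sigma> = (\<Sum>v\<in>{v\<in>V. supp v = \<sigma>}. g v)" for \<sigma>
  have "(\<Sum>\<sigma>\<in>{\<sigma>. \<sigma> \<notin> \<Delta>}. f \<sigma> * sqfree_monomial \<sigma>)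
      = (\<Sum>\<sigma>\<in>{\<sigma>. \<sigma> \<notin> \<Delta>}. \<Sum>v\<in>{v\<in>V. supp v = \<sigma>}. sqfree_monomial (supp v) * g v)"
    unfolding f_def sum_distrib_right by (intro sum.cong) (auto simp: mult_ac)
  also have "\<dots> = p"
    unfolding p by (rule sum.group) (use fin \<Delta> in auto)
  finally show "p \<in> SR_ideal \<Delta>" unfolding SR_ideal_def by blast
qed

section \<open>A cellular resolution\<close>

text \<open>Faces are the sets of vertices with pairwise distinct ranks (a join of discrete sets).
  The assumption \<open>cone\<close> says that the subcomplex of each multidegree is empty or a cone.\<close>

locale cone_complex =
  fixes V :: "'v set" and rk :: "'v \<Rightarrow> nat" and supp :: "'v \<Rightarrow> 'n::finite set"
  assumes finite_vertices: "finite V"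
    and cone: "\<exists>v\<in>V. supp v \<subseteq> b \<Longrightarrow>
      \<exists>u\<in>V. supp u \<subseteq> b \<and> (\<forall>v\<in>V. supp v \<subseteq> b \<longrightarrow> v \<noteq> u \<longrightarrow> rk u < rk v)"
begin

text \<open>The index counts vertices rather than dimension. The empty face thus generates P_0 = S,
  and the augmented chain complex has the numbering of the resolution.\<close>

definition "faces i = {s. s \<subseteq> V \<and> inj_on rk s \<and> card s = i}"
definition "label s = \<Union>(supp ` s)"
definition "link t = {v \<in> V. rk v \<notin> rk ` t}"
definition incidence :: "'v \<Rightarrow> 'v set \<Rightarrow> 'r::comm_ring_1" where
  "incidence v t = (- 1) ^ card {w \<in> t. rk w < rk v}"
text \<open>Here \<open>f\<close> lists the coefficients of a chain, and the value at
  \<open>t\<close> is the coefficient of \<open>t\<close> in its simplicial boundary. Hence the sum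
  runs over the cofaces of \<open>t\<close>, with signs from the order of the vertices by
  rank.\<close>

definition bd :: "('v set \<Rightarrow> 'r::comm_ring_1) \<Rightarrow> 'v set \<Rightarrow> 'r" where
  "bd f t = (\<Sum>v\<in>link t. incidence v t * f (insert v t))"

lemma finite_faces: "finite (faces i)"
  by (rule finite_subset[of _ "Pow V"]) (auto simp: faces_def finite_vertices)

lemma finite_face: "s \<in> faces i \<Longrightarrow> finite s"
  using finite_vertices finite_subset by (auto simp: faces_def)

lemma finite_link: "finite (link t)"
  by (simp add: link_def finite_vertices)

lemma faces_0: "faces 0 = {{}}"
  using finite_vertices finite_subset by (fastforce simp: faces_def)

lemma link_notin: "v \<in> link t \<Longrightarrow> v \<notin> t"
  by (auto simp: link_def)

lemma insert_link_face: "t \<in> faces i \<Longrightarrow> v \<in> link t \<Longrightarrow> insert v t \<in> faces (Suc i)"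
  using finite_face[of t i] link_notin[of v t]
  by (auto simp: faces_def link_def inj_on_insert)

lemma remove_face: "s \<in> faces (Suc i) \<Longrightarrow> v \<in> s \<Longrightarrow> s - {v} \<in> faces i \<and> v \<in> link (s - {v})"
  using finite_face[of s "Suc i"] by (auto simp: faces_def link_def inj_on_def)

lemma face_nonempty: "s \<in> faces (Suc i) \<Longrightarrow> \<exists>v. v \<in> s"
  by (auto simp: faces_def card_Suc_eq)

lemma bd_cong:
  assumes "t \<in> faces i" "\<And>s. s \<in> faces (Suc i) \<Longrightarrow> f s = g s"
  shows "bd f t = bd g t"
  unfolding bd_def using assms insert_link_face by (intro sum.cong) auto

lemma label_insert: "label (insert v t) = supp v \<union> label t"
  by (simp add: label_def)

lemma incidence_insert:
  assumes "finite t" "v \<notin> t"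
  shows "incidence w (insert v t) = (if rk v < rk w then - incidence w t else incidence w t)"
proof -
  have "{x \<in> insert v t. rk x < rk w}
      = (if rk v < rk w then insert v {x \<in> t. rk x < rk w} else {x \<in> t. rk x < rk w})" by auto
  then show ?thesis using assms by (auto simp: incidence_def)
qed

text \<open>Two vertices inserted in either order give the same face with opposite signs.\<close>

lemma bd_bd:
  assumes t: "t \<in> faces i"
  shows "bd (bd f) t = 0"
proof -
  define g where "g v w = incidence v t * (incidence w (insert v t) * f (insert w (insert v t)))" for v w
  let ?less = "{(v, w). v \<in> link t \<and> w \<in> link t \<and> rk v < rk w}"
  let ?gtr = "{(v, w). v \<in> link t \<and> w \<in> link t \<and> rk v > rk w}"
  have fin: "finite ?less" "finite ?gtr"
    by (rule finite_subset[of _ "link t \<times> link t"]; auto simp: finite_link)+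
  have "bd (bd f) t = (\<Sum>v\<in>link t. \<Sum>w\<in>link (insert v t). g v w)"
    by (simp add: bd_def g_def sum_distrib_left)
  also have "\<dots> = sum (\<lambda>(v, w). g v w) (SIGMA v:link t. link (insert v t))"
    by (rule sum.Sigma) (auto simp: finite_link)
  also have "(SIGMA v:link t. link (insert v t)) = ?less \<union> ?gtr"
    by (auto simp: link_def)
  also have "sum (\<lambda>(v, w). g v w) (?less \<union> ?gtr)
      = sum (\<lambda>(v, w). g v w) ?less + sum (\<lambda>(v, w). g v w) ?gtr"
    by (rule sum.union_disjoint) (use fin in auto)
  also have "sum (\<lambda>(v, w). g v w) ?gtr = sum (\<lambda>(v, w). g w v) ?less"
    by (rule sum.reindex_bij_witness[of _ prod.swap prod.swap]) auto
  \<comment> \<open>For \<open>rk v < rk w\<close>, inserting \<open>v\<close> first flips the sign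
    of \<open>w\<close>, whereas inserting \<open>w\<close> first leaves the sign of
    \<open>v\<close> unchanged.\<close>
  also have "\<dots> = sum (\<lambda>(v, w). - g v w) ?less"
    using finite_face[OF t]
    by (intro sum.cong) (auto simp: g_def incidence_insert link_notin insert_commute mult_ac)
  also have "\<dots> = - sum (\<lambda>(v, w). g v w) ?less"
    by (simp add: case_prod_unfold sum_negf)
  finally show ?thesis by simp
qed

section \<open>Contraction of a cone onto its apex\<close>

definition apex :: "'n set \<Rightarrow> 'v" where
  "apex b = (SOME u. u \<in> V \<and> supp u \<subseteq> b \<and> (\<forall>v\<in>V. supp v \<subseteq> b \<longrightarrow> v \<noteq> u \<longrightarrow> rk u < rk v))"

text \<open>Coning with the apex. No sign occurs because the apex has the smallest rank among the
  vertices supported in \<open>b\<close>.\<close>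

definition contraction :: "'n set \<Rightarrow> ('v set \<Rightarrow> 'r::comm_ring_1) \<Rightarrow> 'v set \<Rightarrow> 'r" where
  "contraction b f t = (if apex b \<in> t then f (t - {apex b}) else 0)"

lemma apex:
  assumes "v \<in> V" "supp v \<subseteq> b"
  shows "apex b \<in> V" "supp (apex b) \<subseteq> b"
    "\<And>w. w \<in> V \<Longrightarrow> supp w \<subseteq> b \<Longrightarrow> w \<noteq> apex b \<Longrightarrow> rk (apex b) < rk w"
proof -
  have "\<exists>u. u \<in> V \<and> supp u \<subseteq> b \<and> (\<forall>v\<in>V. supp v \<subseteq> b \<longrightarrow> v \<noteq> u \<longrightarrow> rk u < rk v)"
    using cone[of b] assms by blast
  from someI_ex[OF this] show "apex b \<in> V" "supp (apex b) \<subseteq> b"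
    "\<And>w. w \<in> V \<Longrightarrow> supp w \<subseteq> b \<Longrightarrow> w \<noteq> apex b \<Longrightarrow> rk (apex b) < rk w"
    unfolding apex_def by blast+
qed

text \<open>With at least two vertices in \<open>t\<close>, removing the apex leaves a vertex
  supported in \<open>b\<close>. This guarantees that \<open>apex b\<close> is itself such a
  vertex.\<close>

lemma contraction_support:
  assumes t: "t \<in> faces (Suc (Suc i))" and nz: "contraction b f t \<noteq> 0"
    and f: "\<And>s. s \<in> faces (Suc i) \<Longrightarrow> f s \<noteq> 0 \<Longrightarrow> label s \<subseteq> b"
  shows "label t \<subseteq> b"
proof -
  let ?s = "t - {apex b}"
  from nz have u: "apex b \<in> t" "f ?s \<noteq> 0" by (auto simp: contraction_def split: if_splits)
  have s: "?s \<in> faces (Suc i)" using remove_face[OF t u(1)] by blast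
  then have lab: "label ?s \<subseteq> b" using f u(2) by blast
  from face_nonempty[OF s] obtain v where "v \<in> ?s" by blast
  with s lab have "v \<in> V" "supp v \<subseteq> b" by (auto simp: faces_def label_def)
  from apex(2)[OF this] lab show ?thesis
    using label_insert[of "apex b" ?s] u(1) by (simp add: insert_absorb)
qed

text \<open>Coning is a contracting homotopy of the subcomplex of faces with label in
  \<open>b\<close>, so it fills every cycle \<open>f\<close> supported there. If \<open>s\<close>
  contains the apex, the cycle condition at \<open>s\<close> without the apex determines
  \<open>f s\<close>.\<close>

lemma bd_contraction:
  fixes f :: "'v set \<Rightarrow> 'r::comm_ring_1"
  assumes s: "s \<in> faces (Suc i)"
    and f: "\<And>s. s \<in> faces (Suc i) \<Longrightarrow> f s \<noteq> 0 \<Longrightarrow> label s \<subseteq> b"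
    and cyc: "\<And>t. t \<in> faces i \<Longrightarrow> bd f t = 0"
  shows "bd (contraction b f) s = f s"
proof (cases "label s \<subseteq> b")
  case False
  have "contraction b f (insert v s) = 0" if "v \<in> link s" for v
    using contraction_support[OF insert_link_face[OF s that] _ f] False by (auto simp: label_insert)
  moreover have "f s = 0" using f[OF s] False by blast
  ultimately show ?thesis by (simp add: bd_def)
next
  case True
  have sV: "s \<subseteq> V" and supp_s: "supp v \<subseteq> b" if "v \<in> s" for v
    using s True that by (auto simp: faces_def label_def)
  from face_nonempty[OF s] obtain v0 where v0: "v0 \<in> s" by blast
  with s supp_s have v0': "v0 \<in> V" "supp v0 \<subseteq> b" by (auto simp: faces_def)
  let ?u = "apex b"
  have u: "?u \<in> V" "supp ?u \<subseteq> b" "\<And>w. w \<in> V \<Longrightarrow> supp w \<subseteq> b \<Longrightarrow> w \<noteq> ?u \<Longrightarrow> rk ?u < rk w"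
    using apex[OF v0'] by blast+
  have u_less: "rk ?u < rk w" if "w \<in> s" "w \<noteq> ?u" for w
    using u(3)[of w] that sV supp_s by blast
  show ?thesis
  proof (cases "?u \<in> s")
    case False
    then have link: "?u \<in> link s" using u(1) u_less by (force simp: link_def)
    have "{w \<in> s. rk w < rk ?u} = {}" using u_less False by force
    then have inc: "incidence ?u s = (1 :: 'r)" by (simp only: incidence_def) simp
    \<comment> \<open>Only the insertion of the apex produces a face that contains it.\<close>
    have "bd (contraction b f) s = (\<Sum>v\<in>link s. if v = ?u then f s else 0)"
      unfolding bd_def
      by (intro sum.cong refl) (use False inc in \<open>auto simp: contraction_def\<close>)
    also have "\<dots> = f s" using link by (simp add: finite_link)
    finally show ?thesis .
  next
    case u_in: True
    define s' where "s' = s - {?u}"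
    have s': "s' \<in> faces i" "?u \<in> link s'" using remove_face[OF s u_in] by (auto simp: s'_def)
    have s_eq: "s = insert ?u s'" and u_notin: "?u \<notin> s'" using u_in by (auto simp: s'_def)
    \<comment> \<open>Any other vertex whose rank does not exceed that of the apex is not supported
      in \<open>b\<close>, so its face carries no coefficient.\<close>
    have vanish: "f (insert v s') = 0" if v: "v \<in> link s'" "\<not> rk ?u < rk v" "v \<noteq> ?u" for v
      using f[OF insert_link_face[OF s'(1) v(1)]] u(3)[of v] v by (auto simp: label_insert link_def)
    have link_s: "link s = {v \<in> link s' - {?u}. rk v \<noteq> rk ?u}" by (auto simp: link_def s_eq)
    have "{w \<in> s'. rk w < rk ?u} = {}" using u_less by (force simp: s'_def)
    then have inc: "incidence ?u s' = (1 :: 'r)" by (simp only: incidence_def) simp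
    have "0 = bd f s'" using cyc[OF s'(1)] by simp
    also have "\<dots> = f s + (\<Sum>v\<in>link s' - {?u}. incidence v s' * f (insert v s'))"
      unfolding bd_def using s'(2) by (subst sum.remove[of _ ?u]) (auto simp: finite_link inc s_eq)
    also have "(\<Sum>v\<in>link s' - {?u}. incidence v s' * f (insert v s'))
        = (\<Sum>v\<in>link s. incidence v s' * f (insert v s'))"
      by (rule sum.mono_neutral_right) (use vanish in \<open>auto simp: finite_link link_s\<close>)
    \<comment> \<open>Every \<open>v\<close> with a nonzero coefficient has larger rank than the
      apex, so adding the apex to \<open>s'\<close> flips its incidence sign.\<close>
    also have "\<dots> = (\<Sum>v\<in>link s. - (incidence v s * contraction b f (insert v s)))"
    proof (rule sum.cong[OF refl])
      fix v assume v: "v \<in> link s"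
      then have v': "v \<in> link s'" "v \<noteq> ?u" by (auto simp: link_s)
      have "contraction b f (insert v s) = f (insert v s')"
        using v' u_notin by (auto simp: contraction_def s_eq insert_Diff_if)
      moreover have "f (insert v s') = 0 \<or> incidence v s = (- incidence v s' :: 'r)"
        using vanish[OF v'(1) _ v'(2)] finite_face[OF s'(1)] u_notin
        by (auto simp: s_eq incidence_insert)
      ultimately show "incidence v s' * f (insert v s') = - (incidence v s * contraction b f (insert v s))"
        by auto
    qed
    also have "\<dots> = - bd (contraction b f) s" by (simp add: bd_def sum_negf)
    finally show ?thesis by (simp add: algebra_simps)
  qed
qed

section \<open>The cellular differential over the polynomial ring\<close>

definition weighted_bd :: "('v set \<Rightarrow> ('n, 'k::comm_ring_1) mpoly) \<Rightarrow> 'v set \<Rightarrow> ('n, 'k) mpoly" where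
  "weighted_bd w t = (\<Sum>v\<in>link t. incidence v t * sqfree_monomial (label (insert v t) - label t) * w (insert v t))"

lemma weighted_bd_cong:
  assumes "t \<in> faces i" "\<And>s. s \<in> faces (Suc i) \<Longrightarrow> f s = g s"
  shows "weighted_bd f t = weighted_bd g t"
  unfolding weighted_bd_def using assms insert_link_face by (intro sum.cong) auto

text \<open>Multiplication by the monomial of \<open>label t\<close> turns quotients of labels into
  labels and the weighted differential into the plain boundary. Since this multiplication is
  injective, identities transfer back.\<close>

lemma weighted_bd_bd:
  fixes w :: "'v set \<Rightarrow> ('n, 'k::comm_ring_1) mpoly"
  shows "sqfree_monomial (label t) * weighted_bd w t = bd (\<lambda>s. sqfree_monomial (label s) * w s) t"
proof -
  have "sqfree_monomial (label (insert v t))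
      = sqfree_monomial (label t) * (sqfree_monomial (label (insert v t) - label t) :: ('n, 'k) mpoly)" for v
    by (rule sqfree_monomial_split) (simp add: label_insert)
  then show ?thesis
    unfolding weighted_bd_def bd_def sum_distrib_left by (intro sum.cong refl) (simp add: mult_ac)
qed

text \<open>The signs are constants, so a chain with polynomial coefficients can be treated one
  exponent at a time.\<close>

lemma lookup_bd:
  fixes W :: "'v set \<Rightarrow> ('n, 'k::comm_ring_1) mpoly"
  shows "Poly_Mapping.lookup (bd W t) m = bd (\<lambda>s. Poly_Mapping.lookup (W s) m) t"
proof -
  have "Poly_Mapping.lookup (incidence v t * p) m = incidence v t * Poly_Mapping.lookup p m"
    for v and p :: "('n, 'k) mpoly"
    by (cases "even (card {w \<in> t. rk w < rk v})") (auto simp: incidence_def)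
  then show ?thesis by (simp add: bd_def Poly_Mapping.lookup_sum)
qed

lemma weighted_bd_twice: "t \<in> faces i \<Longrightarrow> weighted_bd (weighted_bd w) t = 0"
  using sqfree_monomial_mult_cancel[of "label t" "weighted_bd (weighted_bd w) t" 0]
  by (simp add: weighted_bd_bd bd_bd)

text \<open>For each exponent \<open>m\<close>, the coefficients at \<open>m\<close> of the chain
  \<open>W\<close> form a cycle on the faces with label in \<open>Poly_Mapping.keys m\<close>, and
  coning fills it.\<close>

lemma weighted_bd_exact:
  fixes w :: "'v set \<Rightarrow> ('n, 'k::comm_ring_1) mpoly"
  assumes cyc: "\<And>t. t \<in> faces i \<Longrightarrow> weighted_bd w t = 0"
  shows "\<exists>u. \<forall>s\<in>faces (Suc i). weighted_bd u s = w s"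
proof -
  define W where "W s = sqfree_monomial (label s) * w s" for s
  \<comment> \<open>Only finitely many exponents occur, so the fillings assemble to polynomials
    \<open>U t\<close>.\<close>
  define M where "M = (\<Union>s\<in>faces (Suc i). Poly_Mapping.keys (W s))"
  define c where "c t m = contraction (Poly_Mapping.keys m) (\<lambda>s. Poly_Mapping.lookup (W s) m) t" for t m
  define U where "U t = (\<Sum>m\<in>M. Poly_Mapping.single m (c t m))" for t
  have W_supp: "Poly_Mapping.lookup (W s) m \<noteq> 0 \<Longrightarrow> label s \<subseteq> Poly_Mapping.keys m" for s m
    unfolding W_def by (rule subset_keys_if_sqfree_monomial_mult)
  have fin: "finite M" by (simp add: M_def finite_faces)
  have lookup_U: "Poly_Mapping.lookup (U t) m = c t m" if t: "t \<in> faces (Suc (Suc i))" for t m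
  proof -
    have "c t m = 0" if m: "m \<notin> M"
    proof (cases "apex (Poly_Mapping.keys m) \<in> t")
      case True
      with remove_face[OF t] m show ?thesis by (auto simp: c_def contraction_def M_def in_keys_iff)
    qed (simp add: c_def contraction_def)
    then show ?thesis
      by (auto simp: U_def Poly_Mapping.lookup_sum lookup_single when_def fin)
  qed
  \<comment> \<open>The exponents in \<open>U t\<close> are positive on \<open>label t\<close>, so
    its monomial can be divided out.\<close>
  have "\<exists>q. U t = sqfree_monomial (label t) * q" if t: "t \<in> faces (Suc (Suc i))" for t
  proof (rule sqfree_monomial_dvd)
    fix m assume "Poly_Mapping.lookup (U t) m \<noteq> 0"
    then show "label t \<subseteq> Poly_Mapping.keys m"
      unfolding lookup_U[OF t] c_def by (rule contraction_support[OF t]) (rule W_supp)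
  qed
  then obtain u where u: "\<And>t. t \<in> faces (Suc (Suc i)) \<Longrightarrow> U t = sqfree_monomial (label t) * u t"
    by metis
  have "weighted_bd u s = w s" if s: "s \<in> faces (Suc i)" for s
  proof -
    have "sqfree_monomial (label s) * weighted_bd u s = W s"
    proof (rule poly_mapping_eqI)
      fix m
      have cyc': "bd (\<lambda>s. Poly_Mapping.lookup (W s) m) t = 0" if "t \<in> faces i" for t
      proof -
        have "bd W t = 0" using weighted_bd_bd[of t w] cyc[OF that] by (simp add: W_def[abs_def])
        then show ?thesis by (simp flip: lookup_bd)
      qed
      have "Poly_Mapping.lookup (sqfree_monomial (label s) * weighted_bd u s) m
          = bd (\<lambda>t. Poly_Mapping.lookup (sqfree_monomial (label t) * u t) m) s"
        by (simp add: weighted_bd_bd lookup_bd)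
      also have "\<dots> = bd (contraction (Poly_Mapping.keys m) (\<lambda>s. Poly_Mapping.lookup (W s) m)) s"
        by (rule bd_cong[OF s]) (simp add: u[symmetric] lookup_U, simp add: c_def)
      also have "\<dots> = Poly_Mapping.lookup (W s) m"
        by (rule bd_contraction[OF s W_supp cyc'])
      finally show "Poly_Mapping.lookup (sqfree_monomial (label s) * weighted_bd u s) m = Poly_Mapping.lookup (W s) m" .
    qed
    then show ?thesis by (simp add: W_def sqfree_monomial_mult_cancel)
  qed
  then show ?thesis by blast
qed

text \<open>The faces with i vertices, in some enumeration, are a basis of P_i. By
  \<open>strict\<close> every nonzero matrix entry is a nonconstant monomial up to sign, which gives
  minimality.\<close>

lemma cellular_resolution:
  assumes \<Delta>: "\<And>\<sigma>. \<sigma> \<notin> \<Delta> \<longleftrightarrow> (\<exists>v\<in>V. supp v \<subseteq> \<sigma>)"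
    and strict: "\<And>i t v. t \<in> faces i \<Longrightarrow> v \<in> link t \<Longrightarrow> label (insert v t) \<noteq> label t"
  obtains r dg and phi :: "nat \<Rightarrow> nat \<Rightarrow> nat \<Rightarrow> ('n, 'k::field) mpoly"
  where "minimal_graded_free_resolution (SR_ideal \<Delta>) r dg phi"
    "\<And>i. r i = card (faces i)"
    "\<And>i l. l < r i \<Longrightarrow> \<exists>s\<in>faces i. dg i l = int (card (label s))"
proof -
  define r where "r i = card (faces i)" for i
  have "\<exists>F. bij_betw F {..<r i} (faces i)" for i
    using ex_bij_betw_nat_finite[OF finite_faces, of i] by (simp add: r_def atLeast0LessThan)
  then obtain F where F: "\<And>i. bij_betw (F i) {..<r i} (faces i)" by metis
  define idx where "idx i = the_inv_into {..<r i} (F i)" for i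
  have F_face: "l < r i \<Longrightarrow> F i l \<in> faces i" for i l
    using bij_betw_apply[OF F] by blast
  have idx_F: "l < r i \<Longrightarrow> idx i (F i l) = l" for i l
    unfolding idx_def using F[of i] by (intro the_inv_into_f_f) (auto simp: bij_betw_def)
  have idx_less: "s \<in> faces i \<Longrightarrow> idx i s < r i" and F_idx: "s \<in> faces i \<Longrightarrow> F i (idx i s) = s" for i s
    using F[of i] bij_betw_the_inv_into[OF F[of i]] f_the_inv_into_f_bij_betw[of "F i"] bij_betw_apply
    by (fastforce simp: idx_def)+
  \<comment> \<open>\<open>the_elem (s - t)\<close> is the vertex missing from \<open>t\<close>; it
    is meaningful when \<open>s\<close> has exactly one vertex more than \<open>t\<close>.\<close>
  define ent :: "'v set \<Rightarrow> 'v set \<Rightarrow> ('n, 'k) mpoly" where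
    "ent t s = (if t \<subseteq> s then incidence (the_elem (s - t)) t * sqfree_monomial (label s - label t) else 0)" for t s
  define phi where "phi i j l = ent (F (i - 1) j) (F i l)" for i j l
  define dg where "dg i l = int (card (label (F i l)))" for i l
  have ent_insert: "ent t (insert v t) = incidence v t * sqfree_monomial (label (insert v t) - label t)"
    if "v \<in> link t" for v t
  proof -
    have "insert v t - t = {v}" using link_notin[OF that] by auto
    then show ?thesis by (auto simp: ent_def)
  qed
  have ent_cases: "ent t s = 0 \<or> (\<exists>v\<in>link t. s = insert v t)"
    if t: "t \<in> faces i" and s: "s \<in> faces (Suc i)" for i s t
  proof (cases "t \<subseteq> s")
    case True
    have "card (s - t) = 1"
      using card_Diff_subset[OF finite_face[OF t] True] s t by (simp add: faces_def)
    then obtain v where "s - t = {v}" by (auto simp: card_1_singleton_iff)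
    then have "s = insert v t" "v \<in> s" "s - {v} = t" using True by auto
    with remove_face[OF s, of v] show ?thesis by auto
  qed (simp add: ent_def)
  \<comment> \<open>Entries between faces that are not nested vanish, so the full matrix product
    reduces to a sum over the link.\<close>
  have weighted_bd_ent: "(\<Sum>s\<in>faces (Suc i). ent t s * w s) = weighted_bd w t" if t: "t \<in> faces i" for t i w
  proof -
    have "(\<Sum>s\<in>faces (Suc i). ent t s * w s) = (\<Sum>s\<in>(\<lambda>v. insert v t) ` link t. ent t s * w s)"
      by (rule sum.mono_neutral_right)
        (use ent_cases[OF t] insert_link_face[OF t] in \<open>fastforce simp: finite_faces\<close>)+
    also have "\<dots> = (\<Sum>v\<in>link t. ent t (insert v t) * w (insert v t))"
    proof (rule sum.reindex_cong[OF _ refl refl])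
      show "inj_on (\<lambda>v. insert v t) (link t)"
        by (rule inj_onI) (metis insert_iff link_notin)
    qed
    also have "\<dots> = weighted_bd w t" by (simp add: weighted_bd_def ent_insert)
    finally show ?thesis .
  qed
  have mat: "differential r phi i v = (\<lambda>j. if j < r i then weighted_bd (\<lambda>s. v (idx (Suc i) s)) (F i j) else 0)" for i v
  proof -
    have "(\<Sum>l<r (Suc i). phi (Suc i) j l * v l) = weighted_bd (\<lambda>s. v (idx (Suc i) s)) (F i j)" if j: "j < r i" for j
    proof -
      have "(\<Sum>l<r (Suc i). phi (Suc i) j l * v l)
          = (\<Sum>l<r (Suc i). ent (F i j) (F (Suc i) l) * v (idx (Suc i) (F (Suc i) l)))"
        by (simp add: phi_def idx_F)
      also have "\<dots> = (\<Sum>s\<in>faces (Suc i). ent (F i j) s * v (idx (Suc i) s))"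
        by (rule sum.reindex_bij_betw[OF F])
      also have "\<dots> = weighted_bd (\<lambda>s. v (idx (Suc i) s)) (F i j)" by (rule weighted_bd_ent[OF F_face[OF j]])
      finally show ?thesis .
    qed
    then show ?thesis by (auto simp: mat_apply_def)
  qed
  have lift: "\<exists>v\<in>fvecs (r i). \<forall>s\<in>faces i. v (idx i s) = u s" for i and u :: "'v set \<Rightarrow> ('n, 'k) mpoly"
    by (rule bexI[of _ "\<lambda>l. if l < r i then u (F i l) else 0"])
      (auto simp: F_idx idx_less fvecs_def)
  have r0: "r 0 = 1" by (simp add: r_def faces_0)
  have F0: "F 0 0 = {}" using F_face[of 0 0] by (simp add: r0 faces_0)
  have link0: "link {} = V" by (simp add: link_def)
  have weighted_bd_empty: "weighted_bd w {} = (\<Sum>v\<in>V. sqfree_monomial (supp v) * w {v})" for w :: "'v set \<Rightarrow> ('n, 'k) mpoly"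
    by (simp add: weighted_bd_def link0 label_def incidence_def)
  have diff0: "differential r phi 0 v 0 = weighted_bd (\<lambda>s. v (idx 1 s)) {}" for v
    using fun_cong[OF mat[of 0 v], of 0] by (simp add: r0 F0)
  have augmentation: "(\<lambda>v. differential r phi 0 v 0) ` fvecs (r 1) = SR_ideal \<Delta>"
  proof -
    have "differential r phi 0 v 0 \<in> range (\<lambda>g. \<Sum>v\<in>V. sqfree_monomial (supp v) * g v)" for v
      unfolding diff0 weighted_bd_empty by (rule range_eqI[where x = "\<lambda>u. v (idx 1 {u})"]) (rule refl)
    moreover have "(\<Sum>v\<in>V. sqfree_monomial (supp v) * g v) \<in> (\<lambda>v. differential r phi 0 v 0) ` fvecs (r 1)" for g
    proof -
      obtain v where v: "v \<in> fvecs (r 1)" "\<forall>s\<in>faces 1. v (idx 1 s) = g (the_elem s)"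
        using lift[of 1 "\<lambda>s. g (the_elem s)"] by blast
      have "differential r phi 0 v 0 = weighted_bd (\<lambda>s. g (the_elem s)) {}"
        unfolding diff0
        by (rule weighted_bd_cong[of _ 0]) (use v in \<open>auto simp: faces_0\<close>)
      also have "\<dots> = (\<Sum>v\<in>V. sqfree_monomial (supp v) * g v)" by (simp add: weighted_bd_empty)
      finally have eq: "differential r phi 0 v 0 = (\<Sum>v\<in>V. sqfree_monomial (supp v) * g v)" .
      show ?thesis by (rule image_eqI[where x = v]) (rule eq[symmetric], rule v(1))
    qed
    ultimately show ?thesis
      unfolding SR_ideal_eq_combinations[OF finite_vertices \<Delta>] by blast
  qed
  have exact: "{v \<in> fvecs (r (Suc i)). differential r phi i v = (\<lambda>_. 0)}
      = differential r phi (Suc i) ` fvecs (r (Suc (Suc i)))" for i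
  proof (intro equalityI subsetI)
    fix v assume "v \<in> {v \<in> fvecs (r (Suc i)). differential r phi i v = (\<lambda>_. 0)}"
    then have v: "v \<in> fvecs (r (Suc i))" "differential r phi i v = (\<lambda>_. 0)" by auto
    have "weighted_bd (\<lambda>s. v (idx (Suc i) s)) t = 0" if "t \<in> faces i" for t
      using fun_cong[OF v(2), of "idx i t"] that by (simp add: mat idx_less F_idx)
    from weighted_bd_exact[OF this] obtain u where
      u: "\<forall>s\<in>faces (Suc i). weighted_bd u s = v (idx (Suc i) s)" by blast
    obtain u' where u': "u' \<in> fvecs (r (Suc (Suc i)))" "\<forall>s\<in>faces (Suc (Suc i)). u' (idx (Suc (Suc i)) s) = u s"
      using lift by blast
    have "differential r phi (Suc i) u' j = v j" for j
    proof (cases "j < r (Suc i)")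
      case True
      have "weighted_bd (\<lambda>s. u' (idx (Suc (Suc i)) s)) (F (Suc i) j) = weighted_bd u (F (Suc i) j)"
        by (rule weighted_bd_cong[OF F_face[OF True]]) (use u' in auto)
      with u True show ?thesis by (simp add: mat F_face idx_F)
    next
      case False
      with v show ?thesis by (simp add: mat fvecs_def)
    qed
    then have "v = differential r phi (Suc i) u'" by auto
    with u' show "v \<in> differential r phi (Suc i) ` fvecs (r (Suc (Suc i)))" by blast
  next
    fix v assume "v \<in> differential r phi (Suc i) ` fvecs (r (Suc (Suc i)))"
    then obtain u where v: "v = differential r phi (Suc i) u" by blast
    have "weighted_bd (\<lambda>s. v (idx (Suc i) s)) t = 0" if t: "t \<in> faces i" for t
    proof -
      have "weighted_bd (\<lambda>s. v (idx (Suc i) s)) t = weighted_bd (weighted_bd (\<lambda>s. u (idx (Suc (Suc i)) s))) t"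
        by (rule weighted_bd_cong[OF t]) (simp add: v mat idx_less F_idx)
      then show ?thesis by (simp add: weighted_bd_twice[OF t])
    qed
    then have "differential r phi i v = (\<lambda>_. 0)" by (auto simp: mat F_face)
    then show "v \<in> {v \<in> fvecs (r (Suc i)). differential r phi i v = (\<lambda>_. 0)}"
      using mat_apply_in_fvecs v by blast
  qed
  have entries: "homogeneous_of (dg (Suc i) l - dg i j) (phi (Suc i) j l)
      \<and> Poly_Mapping.lookup (phi (Suc i) j l) 0 = 0" if jl: "j < r i" "l < r (Suc i)" for i j l
  proof -
    let ?t = "F i j" and ?s = "F (Suc i) l"
    have t: "?t \<in> faces i" and s: "?s \<in> faces (Suc i)" using jl F_face by auto
    from ent_cases[OF this] show ?thesis
    proof
      assume "\<exists>v\<in>link ?t. ?s = insert v ?t"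
      then obtain v where v: "v \<in> link ?t" "?s = insert v ?t" by blast
      have sub: "label ?t \<subseteq> label ?s" by (auto simp: v label_insert)
      have deg: "int (card (label ?s - label ?t)) = dg (Suc i) l - dg i j"
        using card_Diff_subset[OF _ sub] card_mono[OF _ sub] by (simp add: dg_def)
      \<comment> \<open>Strict growth of the labels keeps the quotient monomial different from
        1.\<close>
      have ne: "label ?s - label ?t \<noteq> {}" using strict[OF t v(1)] sub v(2) by auto
      have "phi (Suc i) j l = incidence v ?t * sqfree_monomial (label ?s - label ?t)"
        using ent_insert[OF v(1)] v(2) by (simp add: phi_def)
      then have "phi (Suc i) j l = sqfree_monomial (label ?s - label ?t)
          \<or> phi (Suc i) j l = - sqfree_monomial (label ?s - label ?t)"
        by (cases "even (card {w \<in> ?t. rk w < rk v})") (auto simp: incidence_def)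
      then have nz: "Poly_Mapping.lookup (phi (Suc i) j l) m \<noteq> 0 \<Longrightarrow> m = exponent_of (label ?s - label ?t)" for m
        by (auto simp: sqfree_monomial_eq lookup_single when_def split: if_splits)
      have "exponent_of (label ?s - label ?t) \<noteq> 0"
        using ne total_deg_exponent_of[of "label ?s - label ?t"] by (auto simp: total_deg_def)
      then have "Poly_Mapping.lookup (phi (Suc i) j l) 0 = 0" using nz by metis
      moreover have "homogeneous_of (dg (Suc i) l - dg i j) (phi (Suc i) j l)"
        unfolding homogeneous_of_iff using nz deg total_deg_exponent_of by metis
      ultimately show ?thesis by blast
    qed (simp add: phi_def homogeneous_of_iff)
  qed
  have all: "(\<forall>i\<ge>1. P i) \<longleftrightarrow> (\<forall>i. P (Suc i))" for P :: "nat \<Rightarrow> bool"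
    by (auto simp: Suc_le_eq gr0_conv_Suc)
  have "minimal_graded_free_resolution (SR_ideal \<Delta>) r dg phi"
    unfolding minimal_graded_free_resolution_def graded_free_resolution_def all
    using augmentation exact entries by (simp add: dg_def F0 label_def r0)
  then show ?thesis by (rule that) (use F_face in \<open>auto simp: r_def dg_def\<close>)
qed

end

section \<open>Counting faces\<close>

lemma fq_nonzero: "q > 1 \<Longrightarrow> fq m q \<noteq> 0"
  by (auto simp: fq_def one_less_power less_imp_neq[symmetric])

lemma fq_Suc: "fq (Suc m) q = fq m q * (q ^ Suc m - 1)"
  by (simp add: fq_def mult.commute)

lemma gauss_binom_self: "q > 1 \<Longrightarrow> gauss_binom m m q = 1"
  using fq_nonzero[of q m] by (simp add: gauss_binom_def) (simp add: fq_def)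

lemma gauss_binom_0: "q > 1 \<Longrightarrow> gauss_binom m 0 q = 1"
  using fq_nonzero[of q m] by (simp add: gauss_binom_def) (simp add: fq_def)

text \<open>The q-Pascal rule multiplied by \<open>q ^ i\<close>, so that its second coefficient is
  \<open>q ^ m\<close> instead of \<open>q ^ (m - i)\<close>.\<close>

lemma gauss_binom_Pascal:
  assumes q: "q > 1" and "i < m"
  shows "gauss_binom (Suc m) (Suc i) q * q ^ i = gauss_binom m (Suc i) q * q ^ i + q ^ m * gauss_binom m i q"
proof -
  obtain n where m: "m = Suc (i + n)" using \<open>i < m\<close> less_iff_Suc_add by auto
  define x y where "x = q ^ Suc i - 1" and "y = q ^ Suc n - 1"
  have xy: "x \<noteq> 0" "y \<noteq> 0"
    using one_less_power[OF q, of "Suc i"] one_less_power[OF q, of "Suc n"] by (auto simp: x_def y_def)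
  note nz = fq_nonzero[OF q]
  have diffs: "Suc m - Suc i = Suc n" "m - Suc i = n" "m - i = Suc n" by (auto simp: m)
  \<comment> \<open>This is \<open>q ^ Suc m - 1 = y + q ^ Suc n * x\<close> multiplied by
    \<open>q ^ i\<close>, where \<open>i + Suc n = m\<close>.\<close>
  have "(q ^ Suc m - 1) * q ^ i = q ^ i * y + q ^ m * x"
    by (simp add: x_def y_def m algebra_simps power_add)
  then have "fq m q * (q ^ Suc m - 1) / (fq i q * x * (fq n q * y)) * q ^ i
      = fq m q * (q ^ i * y + q ^ m * x) / (fq i q * x * (fq n q * y))"
    by (simp only: mult.assoc times_divide_eq_left)
  also have "\<dots> = fq m q / (fq i q * x * fq n q) * q ^ i + q ^ m * (fq m q / (fq i q * (fq n q * y)))"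
    using nz[of i] nz[of n] xy by (simp add: field_simps)
  finally show ?thesis
    unfolding gauss_binom_def diffs fq_Suc x_def[symmetric] y_def[symmetric] .
qed

text \<open>The count is the elementary symmetric function e_i of the layer sizes. Whether the top
  layer is met gives the recursion e_i(m+1) = e_i(m) + q^m e_(i-1)(m).\<close>

lemma card_transversals:
  fixes rk :: "'v \<Rightarrow> nat" and q :: nat
  assumes fin: "finite V" and q: "q > 1" and layers: "\<And>j. j < m \<Longrightarrow> card {v \<in> V. rk v = j} = q ^ j"
  shows "real (card {s. s \<subseteq> V \<and> inj_on rk s \<and> card s = i \<and> (\<forall>v\<in>s. rk v < m)})
    = (if i \<le> m then gauss_binom m i (real q) * real q ^ (i * (i - 1) div 2) else 0)"
  using layers
proof (induction m arbitrary: i)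
  case 0
  have "{s. s \<subseteq> V \<and> inj_on rk s \<and> card s = i \<and> (\<forall>v\<in>s. rk v < 0)} = (if i = 0 then {{}} else {})"
    by auto
  then show ?case using q by (simp add: gauss_binom_self)
next
  case (Suc m)
  define X where "X m i = {s. s \<subseteq> V \<and> inj_on rk s \<and> card s = i \<and> (\<forall>v\<in>s. rk v < m)}" for m i
  have finX: "finite (X m i)" for m i
    by (rule finite_subset[of _ "Pow V"]) (auto simp: X_def fin)
  have fins: "finite s" if "s \<in> X m i" for s m i
    using that fin finite_subset by (auto simp: X_def)
  have IH: "real (card (X m i)) = (if i \<le> m then gauss_binom m i (real q) * real q ^ (i * (i - 1) div 2) else 0)" for i
    unfolding X_def by (rule Suc.IH) (use Suc.prems in auto)
  show ?case
  proof (cases i)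
    case 0
    have "{s. s \<subseteq> V \<and> inj_on rk s \<and> card s = 0 \<and> (\<forall>v\<in>s. rk v < Suc m)} = {{}}"
      using fin finite_subset by fastforce
    then show ?thesis using 0 q by (simp add: gauss_binom_0)
  next
    case i: (Suc i')
    let ?P = "{v \<in> V. rk v = m}"
    let ?ins = "\<lambda>(v, s). insert v s"
    have "X (Suc m) (Suc i') = X m (Suc i') \<union> ?ins ` (?P \<times> X m i')"
    proof (intro equalityI subsetI)
      fix s assume s: "s \<in> X (Suc m) (Suc i')"
      show "s \<in> X m (Suc i') \<union> ?ins ` (?P \<times> X m i')"
      proof (cases "\<forall>v\<in>s. rk v < m")
        case True
        with s show ?thesis by (auto simp: X_def)
      next
        case False
        then obtain v where v: "v \<in> s" "rk v = m" using s by (force simp: X_def)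
        have "rk w < m" if "w \<in> s" "w \<noteq> v" for w
        proof -
          have "rk w \<noteq> m" "rk w < Suc m" using s that v by (auto simp: X_def inj_on_def)
          then show ?thesis by simp
        qed
        then have "s - {v} \<in> X m i'"
          using s v fins[OF s] by (auto simp: X_def inj_on_diff)
        moreover have "v \<in> ?P" using s v by (auto simp: X_def)
        moreover have "s = ?ins (v, s - {v})" using v by auto
        ultimately show ?thesis by blast
      qed
    next
      fix s assume "s \<in> X m (Suc i') \<union> ?ins ` (?P \<times> X m i')"
      then show "s \<in> X (Suc m) (Suc i')"
      proof
        assume "s \<in> ?ins ` (?P \<times> X m i')"
        then obtain v t where s: "s = insert v t" "v \<in> V" "rk v = m" and t: "t \<in> X m i'" by auto
        have "v \<notin> t" "rk v \<notin> rk ` t" using s t by (auto simp: X_def)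
        with s t fins[OF t] show ?thesis by (auto simp: X_def inj_on_insert less_Suc_eq)
      qed (auto simp: X_def less_Suc_eq)
    qed
    moreover have "X m (Suc i') \<inter> ?ins ` (?P \<times> X m i') = {}" by (auto simp: X_def)
    moreover have "inj_on ?ins (?P \<times> X m i')"
    proof (rule inj_onI)
      fix p p' assume p: "p \<in> ?P \<times> X m i'" "p' \<in> ?P \<times> X m i'" and eq: "?ins p = ?ins p'"
      obtain v s v' s' where [simp]: "p = (v, s)" "p' = (v', s')" by (metis surj_pair)
      have notin: "v \<notin> s" "v \<notin> s'" "v' \<notin> s" using p by (auto simp: X_def)
      have "v = v'" using eq notin by auto
      then have "s = s'" using eq notin by (metis case_prod_conv insert_ident \<open>p = (v, s)\<close> \<open>p' = (v', s')\<close>)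
      with \<open>v = v'\<close> show "p = p'" by simp
    qed
    ultimately have "card (X (Suc m) (Suc i')) = card (X m (Suc i')) + q ^ m * card (X m i')"
      using Suc.prems[of m]
      by (simp add: card_Un_disjoint finX fin card_image card_cartesian_product)
    then have rec: "real (card (X (Suc m) i))
        = real (card (X m (Suc i'))) + real q ^ m * real (card (X m i'))"
      by (simp add: i)
    have tri: "Suc i' * (Suc i' - 1) div 2 = i' * (i' - 1) div 2 + i'"
      by (cases i') (auto simp: algebra_simps)
    then have qT: "real q ^ (i * (i - 1) div 2) = real q ^ (i' * (i' - 1) div 2) * real q ^ i'"
      unfolding i by (simp only: power_add)
    \<comment> \<open>The case \<open>i' = m\<close> is separate: natural subtraction makes
      \<open>gauss_binom m (Suc m)\<close> nonzero, while the corresponding count is 0.\<close>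
    consider "i' < m" | "i' = m" | "i' > m" by linarith
    then have "real (card (X (Suc m) i))
        = (if i \<le> Suc m then gauss_binom (Suc m) i (real q) * real q ^ (i * (i - 1) div 2) else 0)"
    proof cases
      case 1
      let ?T = "real q ^ (i' * (i' - 1) div 2)"
      have "real (card (X (Suc m) i))
        = (gauss_binom m (Suc i') (real q) * real q ^ i' + real q ^ m * gauss_binom m i' (real q)) * ?T"
        using 1 unfolding rec IH tri by (simp add: power_add algebra_simps)
      also have "\<dots> = gauss_binom (Suc m) (Suc i') (real q) * real q ^ i' * ?T"
        using gauss_binom_Pascal[of "real q" i' m] 1 q by simp
      finally show ?thesis using 1 i unfolding qT by simp
    next
      case 2
      then show ?thesis using q i unfolding rec IH qT by (simp add: gauss_binom_self)
    next
      case 3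
      then show ?thesis using q i unfolding rec IH by simp
    qed
    then show ?thesis by (simp add: X_def)
  qed
qed

section \<open>Supports of subcodes\<close>

definition support :: "'a::zero ^ 'n \<Rightarrow> 'n set" where
  "support c = {i. c $ i \<noteq> 0}"

lemma hweight_support: "hweight c = card (support c)"
  by (simp add: hweight_def support_def)

lemma support_smult: "a \<noteq> 0 \<Longrightarrow> support (a *s c) = support (c :: 'a::field ^ 'n)"
  by (simp add: support_def)

lemma support_eq_empty: "support c = {} \<longleftrightarrow> c = 0"
  by (auto simp: support_def vec_eq_iff)

text \<open>The representation \<open>a *s v + u\<close> is unique, since two of them with different
  scalars would put \<open>v\<close> into \<open>U\<close>.\<close>

lemma card_line_plus_subspace:
  fixes U :: "('a::{finite,field} ^ 'n::finite) set"
  assumes U: "vec.subspace U" and v: "v \<notin> U"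
  shows "card ((\<lambda>(a, u). a *s v + u) ` (UNIV \<times> U)) = CARD('a) * card U"
proof -
  have "inj_on (\<lambda>(a, u). a *s v + u) (UNIV \<times> U)"
  proof (rule inj_onI, clarify)
    fix a b u w assume uw: "u \<in> U" "w \<in> U" and eq: "a *s v + u = b *s v + w"
    have "(a - b) *s v = w - u" using eq by (simp add: vector_sub_rdistrib algebra_simps)
    then have in_U: "(a - b) *s v \<in> U" using vec.subspace_diff[OF U uw(2,1)] by simp
    have "a = b"
    proof (rule ccontr)
      assume "a \<noteq> b"
      then have "v = inverse (a - b) *s ((a - b) *s v)"
        using \<open>a \<noteq> b\<close> by (simp only: vector_smult_assoc left_inverse right_minus_eq) simp
      with vec.subspace_scale[OF U in_U, of "inverse (a - b)"] v show False by simp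
    qed
    with eq show "a = b \<and> u = w" by simp
  qed
  then show ?thesis by (simp add: card_image card_cartesian_product)
qed

lemma span_insert_eq_image:
  "vec.span (insert v S) = (\<lambda>(a, u). a *s v + u) ` (UNIV \<times> vec.span S)"
proof (intro equalityI subsetI)
  fix x assume "x \<in> vec.span (insert v S)"
  then obtain a where "x - a *s v \<in> vec.span S" by (auto simp: vec.span_insert)
  then show "x \<in> (\<lambda>(a, u). a *s v + u) ` (UNIV \<times> vec.span S)"
    by (intro image_eqI[of _ _ "(a, x - a *s v)"]) auto
next
  fix x assume "x \<in> (\<lambda>(a, u). a *s v + u) ` (UNIV \<times> vec.span S)"
  then obtain a u where "x = a *s v + u" "u \<in> vec.span S" by auto
  then show "x \<in> vec.span (insert v S)"
    unfolding vec.span_insert by (auto intro!: exI[of _ a])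
qed

lemma card_span_insert:
  fixes v :: "'a::{finite,field} ^ 'n::finite"
  assumes "v \<notin> vec.span S"
  shows "card (vec.span (insert v S)) = CARD('a) * card (vec.span S)"
  unfolding span_insert_eq_image by (rule card_line_plus_subspace) (simp_all add: assms)

text \<open>Double counting of the pairs of a codeword of \<open>D\<close> and a coordinate in its support.\<close>

lemma card_support_of_subspace:
  fixes D :: "('a::{finite,field} ^ 'n::finite) set"
  assumes D: "vec.subspace D" and card_D: "card D = CARD('a) ^ e"
    and wt: "\<And>c. c \<in> D \<Longrightarrow> c \<noteq> 0 \<Longrightarrow> hweight c = d"
  shows "real (card (\<Union>(support ` D))) * (real CARD('a) - 1) * real CARD('a) ^ e
    = real d * real CARD('a) * (real CARD('a) ^ e - 1)"
proof -
  let ?q = "real CARD('a)" and ?L = "\<Union>(support ` D)"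
  have "(0::'a ^ 'n) \<in> D" by (rule vec.subspace_0[OF D])
  have "(\<Sum>c\<in>D. real (hweight c)) = (\<Sum>c\<in>D - {0}. real (hweight c))"
    using \<open>0 \<in> D\<close> by (subst sum.remove[of D 0]) (auto simp: hweight_def)
  also have "\<dots> = (\<Sum>c\<in>D - {0}. real d)" by (rule sum.cong) (auto simp: wt)
  also have "\<dots> = real d * (?q ^ e - 1)"
    using \<open>0 \<in> D\<close> card_gt_0_iff[of D]
    by (auto simp: card_D[symmetric] of_nat_power[symmetric] of_nat_diff simp del: of_nat_power)
  finally have sum1: "(\<Sum>c\<in>D. real (hweight c)) = real d * (?q ^ e - 1)" .
  \<comment> \<open>The words of \<open>D\<close> that vanish at \<open>i\<close> form a hyperplane,
    so a fraction 1/q of \<open>D\<close> vanishes there.\<close>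
  have col: "?q * real (card {c \<in> D. c $ i \<noteq> 0}) = (?q - 1) * ?q ^ e" if i: "i \<in> ?L" for i
  proof -
    let ?Z = "{c \<in> D. c $ i = 0}"
    obtain c0 where c0: "c0 \<in> D" "c0 $ i \<noteq> 0" using i by (auto simp: support_def)
    have Z: "vec.subspace ?Z"
      using D by (auto simp: vec.subspace_def)
    have "(\<lambda>(a, u). a *s c0 + u) ` (UNIV \<times> ?Z) = D"
    proof (intro equalityI subsetI)
      fix c assume "c \<in> D"
      then have "c - (c $ i / c0 $ i) *s c0 \<in> ?Z"
        using c0 D by (auto intro: vec.subspace_diff vec.subspace_scale)
      then show "c \<in> (\<lambda>(a, u). a *s c0 + u) ` (UNIV \<times> ?Z)"
        by (intro image_eqI[of _ _ "(c $ i / c0 $ i, c - (c $ i / c0 $ i) *s c0)"]) auto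
    qed (use c0 D in \<open>auto intro: vec.subspace_add vec.subspace_scale\<close>)
    then have card_Z: "CARD('a) ^ e = CARD('a) * card ?Z"
      using card_line_plus_subspace[OF Z, of c0] c0 card_D by simp
    have card_split: "card D = card ?Z + card {c \<in> D. c $ i \<noteq> 0}"
      by (subst card_Un_disjoint[symmetric]) (auto intro!: arg_cong[where f = card])
    have "?q ^ e = real (card ?Z) + real (card {c \<in> D. c $ i \<noteq> 0})"
      using arg_cong[OF card_split, of real] unfolding card_D by simp
    moreover have "?q ^ e = ?q * real (card ?Z)"
      using arg_cong[OF card_Z, of real] by simp
    ultimately show ?thesis by (simp add: algebra_simps)
  qed
  have "(\<Sum>c\<in>D. real (hweight c)) = (\<Sum>c\<in>D. \<Sum>i\<in>?L. if c $ i \<noteq> 0 then 1 else 0)"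
  proof (rule sum.cong[OF refl])
    fix c assume "c \<in> D"
    then have "{i. c $ i \<noteq> 0} = {i \<in> ?L. c $ i \<noteq> 0}" by (auto simp: support_def)
    then show "real (hweight c) = (\<Sum>i\<in>?L. if c $ i \<noteq> 0 then 1 else 0)"
      by (simp add: hweight_def sum.If_cases Int_def)
  qed
  also have "\<dots> = (\<Sum>i\<in>?L. real (card {c \<in> D. c $ i \<noteq> 0}))"
    by (subst sum.swap) (simp add: sum.If_cases Int_def)
  finally have "?q * (\<Sum>c\<in>D. real (hweight c)) = (\<Sum>i\<in>?L. (?q - 1) * ?q ^ e)"
    by (simp add: sum_distrib_left col del: UN_iff)
  then show ?thesis by (simp add: sum1 algebra_simps)
qed

text \<open>A linear dependency among the columns in \<open>\<sigma>\<close>, extended by zero, is a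
  codeword supported in \<open>\<sigma>\<close>; conversely such a codeword restricts to a
  dependency.\<close>

lemma nonface_iff_support:
  assumes "is_parity_check C m H"
  shows "\<sigma> \<notin> matroid_complex m H \<longleftrightarrow> (\<exists>c\<in>C. c \<noteq> 0 \<and> support c \<subseteq> \<sigma>)"
proof
  assume "\<sigma> \<notin> matroid_complex m H"
  then obtain a i where a: "\<forall>j<m. (\<Sum>i\<in>\<sigma>. a i * H j $ i) = 0" and i: "i \<in> \<sigma>" "a i \<noteq> 0"
    by (auto simp: matroid_complex_def cols_indep_def)
  define c where "c = (\<chi> i. if i \<in> \<sigma> then a i else 0)"
  have "(\<Sum>i\<in>UNIV. c $ i * H j $ i) = (\<Sum>i\<in>\<sigma>. a i * H j $ i)" for j
    by (rule sum.mono_neutral_cong_right) (auto simp: c_def)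
  then have "c \<in> C" using a assms by (auto simp: is_parity_check_def)
  moreover have "c \<noteq> 0" using i by (auto simp: c_def vec_eq_iff)
  moreover have "support c \<subseteq> \<sigma>" by (auto simp: support_def c_def)
  ultimately show "\<exists>c\<in>C. c \<noteq> 0 \<and> support c \<subseteq> \<sigma>" by blast
next
  assume "\<exists>c\<in>C. c \<noteq> 0 \<and> support c \<subseteq> \<sigma>"
  then obtain c where c: "c \<in> C" "c \<noteq> 0" "support c \<subseteq> \<sigma>" by blast
  have "(\<Sum>i\<in>\<sigma>. c $ i * H j $ i) = (\<Sum>i\<in>UNIV. c $ i * H j $ i)" for j
    by (rule sum.mono_neutral_left) (use c in \<open>auto simp: support_def\<close>)
  then have "\<forall>j<m. (\<Sum>i\<in>\<sigma>. c $ i * H j $ i) = 0"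
    using c(1) assms by (auto simp: is_parity_check_def)
  moreover obtain i where "c $ i \<noteq> 0" using c(2) by (auto simp: vec_eq_iff)
  ultimately show "\<sigma> \<notin> matroid_complex m H"
    using c(3) unfolding matroid_complex_def cols_indep_def support_def by blast
qed

section \<open>The flag of a code\<close>

locale flag =
  fixes b :: "nat \<Rightarrow> 'a::{finite,field} ^ 'n::finite" and k :: nat
  assumes independent: "\<And>j. j < k \<Longrightarrow> b j \<notin> vec.span (b ` {..<j})"
begin

definition "level j = vec.span (b ` {..<j})"
definition "layer j = (\<lambda>u. b j + u) ` level j"
definition "vertices = (\<Union>j<k. layer j)"
text \<open>On a vertex this is the index of its layer (\<open>leader_layer\<close>); it serves as
  the rank function of the complex.\<close>

definition "leader v = (LEAST j. v \<in> level (Suc j))"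

lemma subspace_level: "vec.subspace (level j)"
  by (simp add: level_def)

lemma level_mono: "i \<le> j \<Longrightarrow> level i \<subseteq> level j"
  unfolding level_def by (rule vec.span_mono) auto

lemma level_Suc: "level (Suc j) = (\<lambda>(a, u). a *s b j + u) ` (UNIV \<times> level j)"
  by (simp add: level_def lessThan_Suc span_insert_eq_image)

lemma card_level: "j \<le> k \<Longrightarrow> card (level j) = CARD('a) ^ j"
proof (induction j)
  case (Suc j)
  then show ?case using card_span_insert[OF independent[of j]] by (simp add: level_def lessThan_Suc)
qed (simp add: level_def)

lemma layer_level:
  assumes "v \<in> layer j" "j < k"
  shows "v \<in> level (Suc j)" "v \<notin> level j"
proof -
  obtain u where u: "v = b j + u" "u \<in> level j" using assms(1) by (auto simp: layer_def)
  then show "v \<in> level (Suc j)" unfolding level_Suc by (intro image_eqI[of _ _ "(1, u)"]) auto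
  show "v \<notin> level j"
    using vec.subspace_diff[OF subspace_level _ u(2), of v] independent[OF assms(2)] u(1)
    by (auto simp: level_def)
qed

lemma leader_layer:
  assumes "v \<in> layer j" "j < k"
  shows "leader v = j"
  unfolding leader_def
proof (rule Least_equality)
  show "v \<in> level (Suc j)" by (rule layer_level[OF assms])
  fix y assume "v \<in> level (Suc y)"
  then show "j \<le> y" using layer_level(2)[OF assms] level_mono[of "Suc y" j] by (metis not_less_eq_eq subsetD)
qed

lemma layer_eq: "j < k \<Longrightarrow> {v \<in> vertices. leader v = j} = layer j"
  using leader_layer by (auto simp: vertices_def)

lemma vertexD:
  assumes "v \<in> vertices"
  shows "leader v < k" "v \<in> layer (leader v)"
  using assms leader_layer by (auto simp: vertices_def)

lemma card_layer: "j < k \<Longrightarrow> card (layer j) = CARD('a) ^ j"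
  by (simp add: layer_def card_image card_level)

lemma vertices_level: "vertices \<subseteq> level k"
proof
  fix v assume "v \<in> vertices"
  then obtain j where "j < k" "v \<in> layer j" by (auto simp: vertices_def)
  then show "v \<in> level k" using layer_level(1) level_mono[of "Suc j" k] by auto
qed

text \<open>Dividing a word by its coefficient at the last basis vector that occurs in it produces a
  vertex. The bound on \<open>leader\<close> is what the cone property relies on.\<close>

lemma normalize_vertex:
  assumes "c \<in> level m" "m \<le> k" "c \<noteq> 0"
  shows "\<exists>a v. a \<noteq> 0 \<and> v \<in> vertices \<and> leader v < m \<and> c = a *s v"
  using assms
proof (induction m)
  case 0
  then show ?case by (simp add: level_def)
next
  case (Suc m)
  then obtain a u where c: "c = a *s b m + u" "u \<in> level m" by (auto simp: level_Suc)
  show ?case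
  proof (cases "a = 0")
    case True
    with c Suc show ?thesis by (force simp: less_Suc_eq)
  next
    case False
    let ?v = "b m + inverse a *s u"
    have "?v \<in> layer m"
      using vec.subspace_scale[OF subspace_level c(2)] by (simp add: layer_def)
    moreover have "c = a *s ?v"
      using False by (simp add: c vector_add_ldistrib vector_smult_assoc)
    ultimately show ?thesis
      using Suc.prems(2) False leader_layer[of ?v m] by (intro exI[of _ a] exI[of _ ?v]) (auto simp: vertices_def)
  qed
qed

lemma vertex_nonzero: "v \<in> vertices \<Longrightarrow> v \<noteq> 0"
  using layer_level(2) vec.subspace_0[OF subspace_level] by (auto simp: vertices_def)

text \<open>Two vertices of equal leading index inside the subspace of words supported in \<open>B\<close> would
  differ by a nonzero word of smaller leading index, so the vertex of minimal leading index is unique.\<close>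

sublocale cone_complex vertices leader support
proof
  show "finite vertices" by simp
  fix B assume "\<exists>v\<in>vertices. support v \<subseteq> B"
  then obtain u where u: "u \<in> vertices" "support u \<subseteq> B"
    and min: "\<And>v. v \<in> vertices \<Longrightarrow> support v \<subseteq> B \<Longrightarrow> leader u \<le> leader v"
    using ex_has_least_nat[of "\<lambda>v. v \<in> vertices \<and> support v \<subseteq> B" _ leader] by blast
  have "leader u < leader v" if v: "v \<in> vertices" "support v \<subseteq> B" "v \<noteq> u" for v
  proof (rule ccontr)
    assume "\<not> leader u < leader v"
    then have eq: "leader v = leader u" using min[of v] v by simp
    define j where "j = leader u"
    have "u \<in> layer j" "v \<in> layer j"
      using vertexD(2)[OF u(1)] vertexD(2)[OF v(1)] by (simp_all add: j_def eq)
    then obtain x y where xy: "x \<in> level j" "y \<in> level j" "u = b j + x" "v = b j + y"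
      unfolding layer_def by blast
    have "v - u \<in> level (leader u)"
      using vec.subspace_diff[OF subspace_level xy(2,1)] unfolding j_def[symmetric] by (simp add: xy(3,4))
    moreover have "leader u \<le> k" using vertexD(1)[OF u(1)] by simp
    moreover have "v - u \<noteq> 0" using v(3) by simp
    ultimately obtain a w where w: "a \<noteq> 0" "w \<in> vertices" "leader w < leader u" "v - u = a *s w"
      using normalize_vertex[of "v - u" "leader u"] by blast
    have "support (v - u) \<subseteq> support v \<union> support u" by (auto simp: support_def)
    then have "support (v - u) \<subseteq> B" using u(2) v(2) by blast
    then have "support w \<subseteq> B" using w(1,4) support_smult[of a w] by simp
    with min[of w] w show False by simp
  qed
  with u show "\<exists>u\<in>vertices. support u \<subseteq> B \<and> (\<forall>v\<in>vertices. support v \<subseteq> B \<longrightarrow> v \<noteq> u \<longrightarrow> leader u < leader v)"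
    by blast
qed

lemma card_span_transversal:
  assumes "s \<subseteq> vertices" "inj_on leader s"
  shows "card (vec.span s) = CARD('a) ^ card s"
proof -
  have "finite s" by simp
  then show ?thesis using assms
  \<comment> \<open>A vertex of largest leader is added last. The earlier ones lie in a level that
    does not contain it, so each step multiplies the span by q.\<close>
  proof (induction s rule: finite_ranking_induct[where f = leader])
    case empty
    then show ?case by simp
  next
    case (insert x S)
    show ?case
    proof (cases "x \<in> S")
      case True
      then show ?thesis using insert by (simp add: insert_absorb)
    next
      case False
      have "S \<subseteq> level (leader x)"
      proof
        fix y assume y: "y \<in> S"
        then have "leader y \<le> leader x" "leader y \<noteq> leader x"
          using insert.hyps insert.prems(2) False by (auto simp: inj_on_def)
        then have "leader y < leader x" by simp
        moreover have "y \<in> level (Suc (leader y))"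
          using vertexD[of y] layer_level(1) insert.prems y by blast
        ultimately show "y \<in> level (leader x)" using level_mono[of "Suc (leader y)" "leader x"] by auto
      qed
      then have "vec.span S \<subseteq> level (leader x)" by (rule vec.span_minimal[OF _ subspace_level])
      moreover have "x \<notin> level (leader x)"
        using vertexD[of x] layer_level(2) insert.prems by blast
      ultimately have "x \<notin> vec.span S" by blast
      then show ?thesis using insert False by (simp add: card_span_insert)
    qed
  qed
qed

text \<open>A coordinate that vanishes on \<open>s\<close> vanishes on its span. The label of a face
  is thus the support of a subcode, to which double counting applies.\<close>

lemma label_eq_support_span: "label s = \<Union>(support ` vec.span s)"
proof
  show "label s \<subseteq> \<Union>(support ` vec.span s)"
    unfolding label_def by (intro Union_mono image_mono) (rule vec.span_superset)
  show "\<Union>(support ` vec.span s) \<subseteq> label s"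
  proof clarify
    fix i c assume c: "c \<in> vec.span s" "i \<in> support c"
    have "vec.subspace {c :: 'a ^ 'n. c $ i = 0}" by (auto simp: vec.subspace_def)
    then have "vec.span s \<subseteq> {c. c $ i = 0}" if "s \<subseteq> {c. c $ i = 0}"
      using vec.span_minimal that by blast
    with c show "i \<in> label s" by (force simp: label_def support_def)
  qed
qed

text \<open>The degree formula with cleared denominators. This form also covers the empty face
  \<open>i = 0\<close>, where the strict growth of labels starts.\<close>

lemma card_label_face:
  assumes wt: "\<And>c. c \<in> level k \<Longrightarrow> c \<noteq> 0 \<Longrightarrow> hweight c = d" and s: "s \<in> faces i"
  shows "real (card (label s)) * (real CARD('a) - 1) * real CARD('a) ^ i
    = real d * real CARD('a) * (real CARD('a) ^ i - 1)"
  unfolding label_eq_support_span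
proof (rule card_support_of_subspace)
  show "card (vec.span s) = CARD('a) ^ i"
    using s card_span_transversal[of s] by (simp add: faces_def)
  have "vec.span s \<subseteq> level k"
    using s vertices_level by (intro vec.span_minimal[OF _ subspace_level]) (auto simp: faces_def)
  then show "hweight c = d" if "c \<in> vec.span s" "c \<noteq> 0" for c using wt that by blast
qed simp

lemma card_faces:
  "real (card (faces i)) = (if i \<le> k then gauss_binom k i (real CARD('a)) * real CARD('a) ^ (i * (i - 1) div 2) else 0)"
proof -
  have "CARD('a) > 1" using card_mono[of UNIV "{0, 1 :: 'a}"] by simp
  moreover have "faces i = {s. s \<subseteq> vertices \<and> inj_on leader s \<and> card s = i \<and> (\<forall>v\<in>s. leader v < k)}"
    using vertexD(1) by (auto simp: faces_def)
  ultimately show ?thesis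
    using card_transversals[of vertices "CARD('a)" k leader i] by (simp add: layer_eq card_layer)
qed

end

text \<open>The initial segments of any enumerated basis of \<open>C\<close> span a flag.\<close>

lemma subspace_eq_level:
  fixes C :: "('a::{finite,field} ^ 'n::finite) set"
  assumes "vec.subspace C" "vec.dim C = k"
  obtains b where "flag b k" "flag.level b k = C"
proof -
  obtain B where B: "B \<subseteq> C" "vec.independent B" "C \<subseteq> vec.span B" "card B = k"
    using vec.basis_exists[of C] assms(2) by metis
  obtain b where b: "bij_betw b {..<k} B"
    using ex_bij_betw_nat_finite[of B] B(4) by (auto simp: atLeast0LessThan)
  have fl: "flag b k"
  proof
    fix j assume j: "j < k"
    have "b ` {..<j} \<subseteq> B - {b j}"
      using b j by (auto simp: bij_betw_def inj_on_def)
    then have "vec.span (b ` {..<j}) \<subseteq> vec.span (B - {b j})" by (rule vec.span_mono)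
    moreover have "b j \<in> B" using b j by (auto simp: bij_betw_def)
    ultimately show "b j \<notin> vec.span (b ` {..<j})"
      using B(2) by (auto simp: vec.dependent_def)
  qed
  have "vec.span B = C" using B vec.span_minimal[OF B(1) assms(1)] by blast
  then have "flag.level b k = C"
    using b by (simp add: flag.level_def[OF fl] bij_betw_def)
  with fl show ?thesis by (rule that)
qed

section \<open>Constant weight codes: existence of the resolution and uniqueness of its
  shape\<close>

theorem theorem2:
  fixes C :: "(('a::{finite,field}) ^ ('n::finite)) set"
    and H :: "nat \<Rightarrow> 'a ^ 'n"
    and k d :: nat
  assumes "vec.subspace C"
    and "vec.dim C = k"
    and "k \<ge> 1"
    and "\<forall>c\<in>C. c \<noteq> 0 \<longrightarrow> hweight c = d"
    and "is_parity_check C (CARD('n) - k) H"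
  shows "(\<exists>r dg (phi :: nat \<Rightarrow> nat \<Rightarrow> nat \<Rightarrow> ('n, 'k::field) mpoly).
            minimal_graded_free_resolution (SR_ideal (matroid_complex (CARD('n) - k) H)) r dg phi
            \<and> has_shape CARD('a) k d r dg)
       \<and> (\<forall>r dg (phi :: nat \<Rightarrow> nat \<Rightarrow> nat \<Rightarrow> ('n, 'k) mpoly).
            minimal_graded_free_resolution (SR_ideal (matroid_complex (CARD('n) - k) H)) r dg phi
            \<longrightarrow> has_shape CARD('a) k d r dg)"
proof -
  let ?\<Delta> = "matroid_complex (CARD('n) - k) H" and ?q = "real CARD('a)"
  obtain b where "flag b k" and level: "flag.level b k = C"
    using subspace_eq_level[OF assms(1,2)] .
  interpret flag b k by fact
  have q: "?q > 1" using card_mono[of UNIV "{0, 1 :: 'a}"] by simp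
  note label_card = card_label_face[of d, unfolded level]
  have wt: "\<And>c. c \<in> C \<Longrightarrow> c \<noteq> 0 \<Longrightarrow> hweight c = d" using assms(4) by blast
  have \<Delta>: "\<sigma> \<notin> ?\<Delta> \<longleftrightarrow> (\<exists>v\<in>vertices. support v \<subseteq> \<sigma>)" for \<sigma>
  proof -
    have "\<exists>v\<in>vertices. support v = support c" if c: "c \<in> C" "c \<noteq> 0" for c
    proof -
      obtain a v where "a \<noteq> 0" "v \<in> vertices" "c = a *s v"
        using normalize_vertex[of c k] c by (auto simp: level)
      then show ?thesis using support_smult[of a v] by auto
    qed
    moreover have "v \<in> C \<and> v \<noteq> 0" if "v \<in> vertices" for v
      using vertices_level vertex_nonzero that level by auto
    ultimately show ?thesis
      unfolding nonface_iff_support[OF assms(5)] by metis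
  qed
  \<comment> \<open>Equal labels would make the counting formulas for \<open>i\<close> and
    \<open>Suc i\<close> differ by d q (q - 1) = 0, but d > 0 because a vertex is a nonzero
    codeword.\<close>
  have strict: "label (insert v t) \<noteq> label t" if t: "t \<in> faces i" and v: "v \<in> link t" for i t v
  proof
    assume eq: "label (insert v t) = label t"
    have "v \<in> vertices" using v by (simp add: link_def)
    then have "v \<in> C" "v \<noteq> 0" using vertices_level vertex_nonzero level by auto
    then have "d > 0"
      using wt[of v] support_eq_empty[of v] by (auto simp: hweight_support card_gt_0_iff)
    have "real d * ?q * (?q ^ Suc i - 1) = ?q * (real (card (label t)) * (?q - 1) * ?q ^ i)"
      using label_card[OF wt insert_link_face[OF t v]] eq by simp
    also have "\<dots> = ?q * (real d * ?q * (?q ^ i - 1))"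
      using label_card[OF wt t] by simp
    finally have "real d * ?q * (?q - 1) = 0" by (simp add: algebra_simps)
    with \<open>d > 0\<close> q show False by simp
  qed
  obtain r dg and phi :: "nat \<Rightarrow> nat \<Rightarrow> nat \<Rightarrow> ('n, 'k) mpoly" where
    res: "minimal_graded_free_resolution (SR_ideal ?\<Delta>) r dg phi"
    and r: "\<And>i. r i = card (faces i)"
    and dg: "\<And>i l. l < r i \<Longrightarrow> \<exists>s\<in>faces i. dg i l = int (card (label s))"
  proof (rule cellular_resolution[where 'k = 'k, OF \<Delta>])
    show "label (insert v t) \<noteq> label t" if "t \<in> faces i" "v \<in> link t" for i t v
      by (rule strict[OF that])
  qed (rule that)
  have degree: "real_of_int (dg i l) = real d * (?q ^ i - 1) / (?q ^ (i - 1) * (?q - 1))"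
    if i: "1 \<le> i" and l: "l < r i" for i l
  proof -
    obtain s where s: "s \<in> faces i" "dg i l = int (card (label s))" using dg[OF l] by blast
    \<comment> \<open>One factor q is split off and cancelled to reach the exponent
      \<open>i - 1\<close> of the required formula.\<close>
    have "?q ^ i = ?q * ?q ^ (i - 1)" using i by (cases i) auto
    then have "?q * (real (card (label s)) * ((?q - 1) * ?q ^ (i - 1))) = ?q * (real d * (?q ^ i - 1))"
      using label_card[OF wt s(1)] by (simp add: algebra_simps)
    then have "real (card (label s)) * (?q ^ (i - 1) * (?q - 1)) = real d * (?q ^ i - 1)"
      using q by (simp add: mult.commute)
    moreover have "?q ^ (i - 1) * (?q - 1) \<noteq> 0" using q by simp
    ultimately show ?thesis by (simp only: s(2) of_int_of_nat_eq eq_divide_eq simp_thms if_True if_False)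
  qed
  \<comment> \<open>All cellular generators in step \<open>i\<close> have the same degree, so for
    any resolution with these ranks it suffices that each of its degrees occurs among the cellular
    ones.\<close>
  have shapeI: "has_shape CARD('a) k d r e"
    if e: "\<And>i l. 1 \<le> i \<Longrightarrow> l < r i \<Longrightarrow> \<exists>j<r i. e i l = dg i j" for e
  proof -
    have "real_of_int (e i l) = real d * (?q ^ i - 1) / (?q ^ (i - 1) * (?q - 1))"
      if il: "1 \<le> i" "l < r i" for i l
    proof -
      obtain j where "j < r i" "e i l = dg i j" using e[OF il] by blast
      then show ?thesis using degree[OF il(1)] by simp
    qed
    moreover have "r i = 0" if "i > k" for i using card_faces[of i] that by (simp add: r)
    moreover have "real (r i) = gauss_binom k i ?q * ?q ^ (i * (i - 1) div 2)" if "i \<le> k" for i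
      using card_faces[of i] that by (simp add: r)
    ultimately show ?thesis unfolding has_shape_def by blast
  qed
  have "has_shape CARD('a) k d r' dg'"
    if res': "minimal_graded_free_resolution (SR_ideal ?\<Delta>) r' dg' phi'"
    for r' dg' and phi' :: "nat \<Rightarrow> nat \<Rightarrow> nat \<Rightarrow> ('n, 'k) mpoly"
  proof -
    have gr: "graded_free_resolution (SR_ideal ?\<Delta>) r dg phi" "graded_free_resolution (SR_ideal ?\<Delta>) r' dg' phi'"
      using res res' by (auto simp: minimal_graded_free_resolution_def)
    \<comment> \<open>Both resolutions are minimal, so the rank inequality applies in both
      directions.\<close>
    have "r' i = r i" for i
      using minimal_resolution_ranks_le(1)[OF res gr(2)] minimal_resolution_ranks_le(1)[OF res' gr(1)]
      by (simp add: order_antisym)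
    then have "r' = r" by blast
    then show ?thesis
      using shapeI[of dg'] minimal_resolution_ranks_le(2)[OF res' gr(1)] by blast
  qed
  moreover have "has_shape CARD('a) k d r dg" by (rule shapeI) blast
  ultimately show ?thesis using res by blast
qed

end
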